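(* The set \[ \left\{ \frac{\varphi(p+1)}{\varphi(p)} \,:\, p \text{ prime} \right\} \] is dense in $\left[0,\tfrac{1}{2}\right]$.
   Context: $\varphi$ denotes Euler's totient function. This statement is unconditional. *)

theory Defs
  imports "HOL-Analysis.Analysis" "HOL-Number_Theory.Number_Theory"
begin

end

(* Since (p+1)/(p-1) tends to 1, it suffices to control phi(p+1)/(p+1), the product of 1 - 1/q over
   the primes q dividing p+1.  The product of 1 - 1/q over y < q <= w tends to 0 as w grows, in steps
   of ratio at least 1 - 1/y, so 2 together with the primes in (y, w] can be arranged to give a
   product close to the target.  Prescribing p modulo the product P of all primes up to w fixes
   exactly which primes q <= w divide p+1.  It remains to find p in this class for which the sum E(p)
   of 1/q over primes q > w dividing p+1 is small.  Average E(p) over the class with the weights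
   (ln p)/p, p <= N: for bounded q, Mertens' theorem in residue classes modulo P q gives the exact
   frequency 1/(q-1); for large q, the primes p = -1 (mod q) are bounded in a Chebyshev manner with
   a loss of only ln q, since the primes in (N, q N] from this class divide the numerator of
   (q-1)(2q-1)...(Nq-1)/N!.  As the series of (ln q)/q^2 converges, the average of E is at most
   about 1/w.  The moduli are squarefree, so primitive roots modulo primes provide enough
   characters. *)
theory Submission
  imports Defs "HOL-Computational_Algebra.Squarefree"
begin

section \<open>Chebyshev and Mertens estimates\<close>

text \<open>The obstacle is that a prime q dividing p + 1 may be as large as N + 1, so no asymptotic
  with fixed moduli covers all q. Counting all integers n = -1 (mod q) would bound the weighted sum
  only by a multiple of (ln N)^2 / q, too large by a factor ln N; the Chebyshev bound for this class
  has ln q in place of one ln N, and the further 1/q from E makes the sum over q converge. With the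
  weights (ln p)/p the main terms have size ln N and errors need only be bounded, so Mertens'
  theorem suffices, without uniformity in the modulus: its uncontrolled errors occur only for the
  finitely many q <= Z, and Z is fixed before N. The decisive input is that L(1, \<eta>) is nonzero
  for nonprincipal \<eta>. It is obtained from partial sums alone, without complex analysis.\<close>

text \<open>Both sides run over the pairs d, k with d * k <= N. All convolutions below are summed
  this way: the expansion of ln, its twists by characters, and Lambert sums.\<close>

lemma sum_divisors_swap:
  fixes f :: "nat \<Rightarrow> nat \<Rightarrow> 'a::comm_monoid_add"
  shows "(\<Sum>n=1..N. \<Sum>d | d dvd n. f d (n div d)) = (\<Sum>d=1..N. \<Sum>k=1..N div d. f d k)"
proof -
  have "(\<Sum>n=1..N. \<Sum>d | d dvd n. f d (n div d))
      = (\<Sum>(n,d)\<in>(SIGMA n:{1..N}. {d. d dvd n}). f d (n div d))"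
    by (rule sum.Sigma) (auto intro: finite_divisors_nat)
  also have "\<dots> = (\<Sum>(d,k)\<in>(SIGMA d:{1..N}. {1..N div d}). f d k)"
  proof (rule sum.reindex_bij_witness[where i="\<lambda>(d,k). (d*k,d)" and j="\<lambda>(n,d). (d, n div d)"])
    fix x assume "x \<in> (SIGMA n:{1..N}. {d. d dvd n})"
    then obtain n d where x: "x = (n, d)" "n \<in> {1..N}" "d dvd n" by auto
    hence "0 < d" "d \<le> n" by (auto dest: dvd_imp_le intro: Nat.gr0I)
    thus "(case x of (n, d) \<Rightarrow> (d, n div d)) \<in> (SIGMA d:{1..N}. {1..N div d})"
      using x by (auto simp: div_le_mono Suc_le_eq div_greater_zero_iff)
  next
    fix x assume "x \<in> (SIGMA d:{1..N}. {1..N div d})"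
    then obtain d k where x: "x = (d, k)" "d \<in> {1..N}" "1 \<le> k" "k \<le> N div d" by auto
    hence "k * d \<le> N" by (simp add: less_eq_div_iff_mult_less_eq)
    thus "(case x of (d, k) \<Rightarrow> (d * k, d)) \<in> (SIGMA n:{1..N}. {d. d dvd n})"
      using x by (auto simp: mult.commute)
  qed auto
  also have "\<dots> = (\<Sum>d=1..N. \<Sum>k=1..N div d. f d k)"
    by (rule sum.Sigma[symmetric]) auto
  finally show ?thesis .
qed

text \<open>ln n is the sum of \<open>mangoldt\<close> over the divisors of n, and
  \<open>N div d\<close> counts the multiples of d up to N.\<close>

lemma ln_fact_eq_sum_mangoldt:
  "ln (fact N :: real) = (\<Sum>d=1..N. mangoldt d * real (N div d))"
proof -
  have "ln (fact N :: real) = (\<Sum>n=1..N. ln (real n))"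
    unfolding fact_prod of_nat_prod by (subst ln_prod) auto
  also have "\<dots> = (\<Sum>n=1..N. \<Sum>d | d dvd n. mangoldt d)"
    by (rule sum.cong) (auto simp: mangoldt_sum)
  also have "\<dots> = (\<Sum>d=1..N. \<Sum>k=1..N div d. mangoldt d)"
    by (rule sum_divisors_swap)
  finally show ?thesis by (simp add: mult.commute)
qed

lemma ln_fact_Suc: "ln (fact (Suc N) :: real) = ln (real (Suc N)) + ln (fact N)"
  unfolding fact_Suc by (rule ln_mult_pos) auto

text \<open>A crude Stirling formula: an error of N becomes a bounded one when Mertens' theorem
  divides by N.\<close>

lemma ln_fact_bounds:
  shows "ln (fact N :: real) \<le> real N * ln (real N)"
    and "real N * ln (real N) - real N \<le> ln (fact N :: real)"
proof -
  show "ln (fact N :: real) \<le> real N * ln (real N)"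
  proof (cases "N = 0")
    case False
    have "(fact N :: real) \<le> real N ^ N"
      by (metis fact_le_power le_refl of_nat_fact of_nat_le_iff of_nat_power)
    hence "ln (fact N :: real) \<le> ln (real N ^ N)"
      using False by (subst ln_le_cancel_iff) auto
    thus ?thesis using False by (simp add: ln_realpow)
  qed auto
  show "real N * ln (real N) - real N \<le> ln (fact N :: real)"
  proof (induction N)
    case (Suc N)
    show ?case
    proof (cases "N = 0")
      case False
      have "ln (real (Suc N) / real N) \<le> real (Suc N) / real N - 1"
        using False by (intro ln_le_minus_one) auto
      hence "ln (real (Suc N)) - ln (real N) \<le> 1 / real N"
        using False by (simp add: ln_div field_simps)
      hence "real N * (ln (real (Suc N)) - ln (real N)) \<le> 1"
        using False by (simp add: field_simps)
      thus ?thesis using Suc False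
        by (simp add: ln_fact_Suc algebra_simps del: fact_Suc)
    qed auto
  qed auto
qed

text \<open>The logarithm of \<open>(2*N) choose N\<close> gives each d the weight
  \<open>2*N div d\<close> - 2 (\<open>N div d\<close>), which is never negative and equals 1 on (N,
  2 N]; the coefficient is at most 4^N.\<close>

lemma mangoldt_dyadic: "(\<Sum>d\<in>{N<..2*N}. mangoldt d) \<le> 2 * real N"
proof -
  have "(\<Sum>d\<in>{N<..2*N}. mangoldt d) \<le> (\<Sum>d=1..2*N. mangoldt d * (real (2*N div d) - 2 * real (N div d)))"
  proof -
    have *: "2 * real (N div d) \<le> real (2*N div d)" for d
    proof -
      have "2 * (N div d) \<le> 2 * N div d"
        by (cases "d = 0") (auto simp: less_eq_div_iff_mult_less_eq mult.assoc)
      thus ?thesis by linarith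
    qed
    have "(\<Sum>d\<in>{N<..2*N}. mangoldt d) \<le> (\<Sum>d\<in>{N<..2*N}. mangoldt d * (real (2*N div d) - 2 * real (N div d)))"
    proof (rule sum_mono)
      fix d assume d: "d \<in> {N<..2*N}"
      have "1 \<le> 2*N div d"
        using d by (subst less_eq_div_iff_mult_less_eq) auto
      moreover have "N div d = 0" using d by auto
      ultimately show "mangoldt d \<le> mangoldt d * (real (2*N div d) - 2 * real (N div d))"
        using mangoldt_nonneg[of d] by (simp add: mult_le_cancel_left1)
    qed
    also have "\<dots> \<le> (\<Sum>d=1..2*N. mangoldt d * (real (2*N div d) - 2 * real (N div d)))"
      by (rule sum_mono2) (use * in \<open>auto intro!: mult_nonneg_nonneg mangoldt_nonneg\<close>)
    finally show ?thesis .
  qed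
  also have "\<dots> = ln (fact (2*N)) - 2 * (\<Sum>d=1..2*N. mangoldt d * real (N div d))"
    unfolding ln_fact_eq_sum_mangoldt right_diff_distrib sum_subtractf sum_distrib_left
    by (intro arg_cong2[where f="(-)"] refl sum.cong) simp_all
  also have "(\<Sum>d=1..2*N. mangoldt d * real (N div d)) = ln (fact N)"
    unfolding ln_fact_eq_sum_mangoldt
    by (rule sum.mono_neutral_right) auto
  also have "ln (fact (2*N)) - 2 * ln (fact N) = ln (real ((2*N) choose N))"
  proof -
    have "ln (fact (2*N) / (fact N * fact N) :: real) = ln (fact (2*N)) - (ln (fact N) + ln (fact N))"
      by (subst ln_div) (auto simp: ln_mult)
    moreover have "2 * N - N = N" by simp
    hence "real ((2*N) choose N) = fact (2*N) / (fact N * fact N)"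
      using binomial_fact[of N "2*N", where 'a=real] by (simp only: le_add1 mult_2 add_diff_cancel_left')
    ultimately show ?thesis by (simp only: mult_2)
  qed
  also have "\<dots> \<le> ln (2 ^ (2*N))"
  proof (subst ln_le_cancel_iff)
    have "(2*N) choose N \<le> 2 ^ (2*N)" by (rule binomial_le_pow2)
    thus "real ((2*N) choose N) \<le> 2 ^ (2*N)"
      by (metis of_nat_le_iff of_nat_numeral of_nat_power)
  qed auto
  also have "\<dots> = 2 * real N * ln 2" by (simp add: ln_realpow)
  also have "\<dots> \<le> 2 * real N * 1" by (intro mult_left_mono) (use ln_le_minus_one[of 2] in auto)
  finally show ?thesis by simp
qed

text \<open>Descent to M, half of N rounded up: the claim for M and the interval (M, 2 M] together
  cost 6 M. For even N a constant 2 would reproduce itself; 4 leaves room for the rounding.\<close>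

lemma chebyshev_psi_le: "(\<Sum>d=1..N. mangoldt d) \<le> 4 * real N"
proof (induction N rule: less_induct)
  case (less N)
  show ?case
  proof (cases "N \<le> 1")
    case True
    hence "N = 0 \<or> N = 1" by auto
    thus ?thesis by auto
  next
    case False
    define M where "M = (N + 1) div 2"
    have M: "M < N" "N \<le> 2 * M" "2 * M \<le> N + 1" using False by (auto simp: M_def)
    have "(\<Sum>d=1..N. mangoldt d :: real) \<le> (\<Sum>d=1..2*M. mangoldt d)"
      by (rule sum_mono2) (use M in \<open>auto simp: mangoldt_nonneg\<close>)
    also have "{1..2*M} = {1..M} \<union> {M<..2*M}" by auto
    also have "sum mangoldt \<dots> = (\<Sum>d=1..M. mangoldt d) + (\<Sum>d\<in>{M<..2*M}. mangoldt d :: real)"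
      by (rule sum.union_disjoint) auto
    also have "\<dots> \<le> 4 * real M + 2 * real M"
      using less[OF M(1)] mangoldt_dyadic[of M] by linarith
    also have "\<dots> \<le> 4 * real N"
    proof -
      have "6 * M \<le> 4 * N" using M False by linarith
      thus ?thesis by linarith
    qed
    finally show ?thesis .
  qed
qed

text \<open>Removing the floors in the expansion of \<open>ln (fact N)\<close> adds between 0 and
  psi(N) <= 4 N in total; division by N turns this into the 4.\<close>

lemma mertens_mangoldt:
  assumes "N > 0"
  shows "\<bar>(\<Sum>d=1..N. mangoldt d / real d) - ln (real N)\<bar> \<le> 4"
proof -
  let ?S = "\<Sum>d=1..N. mangoldt d / real d :: real"
  have le: "real (N div d) \<le> real N / real d" for d
    by (metis floor_divide_of_nat_eq of_int_floor_le of_int_of_nat_eq)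
  have ge: "real N / real d - 1 \<le> real (N div d)" if "d > 0" for d
    using that floor_divide_of_nat_eq[of N d, where 'a=real] by linarith
  have "ln (fact N) \<le> (\<Sum>d=1..N. mangoldt d * (real N / real d))"
    unfolding ln_fact_eq_sum_mangoldt using le by (intro sum_mono mult_left_mono mangoldt_nonneg)
  also have "\<dots> = real N * ?S" by (simp add: sum_distrib_left mult.commute)
  finally have "real N * ln (real N) - real N \<le> real N * ?S"
    using ln_fact_bounds(2)[of N] by linarith
  hence "real N * (ln (real N) - 1) \<le> real N * ?S" by (simp add: algebra_simps)
  hence 1: "ln (real N) - 1 \<le> ?S" using assms by simp
  have "real N * ?S - (\<Sum>d=1..N. mangoldt d) = (\<Sum>d=1..N. mangoldt d * (real N / real d - 1))"
    by (simp add: sum_distrib_left sum_subtractf algebra_simps)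
  also have "\<dots> \<le> ln (fact N)"
    unfolding ln_fact_eq_sum_mangoldt using ge by (intro sum_mono mult_left_mono mangoldt_nonneg) auto
  also have "\<dots> \<le> real N * ln (real N)" by (rule ln_fact_bounds)
  finally have "real N * ?S \<le> real N * (ln (real N) + 4)"
    using chebyshev_psi_le[of N] by (simp add: algebra_simps)
  hence "?S \<le> ln (real N) + 4" using assms by simp
  thus ?thesis using 1 by linarith
qed

section \<open>Terms of Mertens' sum at multiples of a prime and at proper prime powers\<close>

lemma sum_inverse_powers_le:
  assumes "q \<ge> (2::nat)"
  shows "(\<Sum>j=a..b. 1 / real (q ^ j)) \<le> 1 / (real q ^ a * (1 - 1 / real q))"
proof (cases "a \<le> b")
  case True
  have "(\<Sum>j=a..b. 1 / real (q ^ j)) = (\<Sum>j=a..b. (1 / real q) ^ j)"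
    by (simp add: power_one_over)
  also have "\<dots> = ((1 / real q) ^ a - (1 / real q) ^ Suc b) / (1 - 1 / real q)"
    using assms True by (subst sum_gp) auto
  also have "\<dots> \<le> (1 / real q) ^ a / (1 - 1 / real q)"
    using assms by (intro divide_right_mono) auto
  finally show ?thesis by (simp add: power_one_over field_simps)
qed (use assms in auto)

lemma mangoldt_nonzeroE:
  assumes "mangoldt d \<noteq> (0::real)"
  obtains p k where "prime p" "k > 0" "d = p ^ k"
  using assms by (auto simp: mangoldt_def primepow_def split: if_splits)

text \<open>Among the multiples of q only the powers of q carry weight, so a geometric series bounds
  the sum independently of N.\<close>

lemma sum_mangoldt_multiples_le:
  assumes "prime q"
  shows "(\<Sum>d | d \<in> {1..N} \<and> q dvd d. mangoldt d / real d) \<le> ln (real q) / (real q - 1)"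
proof -
  have q: "q \<ge> 2" using assms by (rule prime_ge_2_nat)
  have "(\<Sum>d | d \<in> {1..N} \<and> q dvd d. mangoldt d / real d :: real)
      = (\<Sum>d | d \<in> {1..N} \<and> q dvd d \<and> mangoldt d \<noteq> (0::real). mangoldt d / real d)"
    by (rule sum.mono_neutral_right) auto
  also have "\<dots> \<le> (\<Sum>d\<in>(\<lambda>j. q ^ j) ` {1..N}. mangoldt d / real d)"
  proof (rule sum_mono2)
    show "{d. d \<in> {1..N} \<and> q dvd d \<and> mangoldt d \<noteq> (0::real)} \<subseteq> (\<lambda>j. q ^ j) ` {1..N}"
    proof safe
      fix d assume d: "d \<in> {1..N}" "q dvd d" "mangoldt d \<noteq> (0::real)"
      obtain p k where pk: "prime p" "k > 0" "d = p ^ k" using d(3) mangoldt_nonzeroE by blast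
      have "p = q" using pk assms d by (metis prime_dvd_power_nat primes_dvd_imp_eq)
      moreover have "k < q ^ k" using q by (intro power_gt_expt) auto
      ultimately show "d \<in> (\<lambda>j. q ^ j) ` {1..N}" using pk d(1) by auto
    qed
  qed (auto simp: mangoldt_nonneg)
  also have "\<dots> = (\<Sum>j=1..N. ln (real q) * (1 / real (q ^ j)))"
    using q by (subst sum.reindex) (auto simp: inj_on_def mangoldt_primepow[OF assms])
  also have "\<dots> \<le> ln (real q) * (1 / (real q ^ 1 * (1 - 1 / real q)))"
    unfolding sum_distrib_left[symmetric] using q by (intro mult_left_mono sum_inverse_powers_le) auto
  also have "\<dots> = ln (real q) / (real q - 1)" using q by (simp add: field_simps)
  finally show ?thesis .
qed

lemma sum_UN_le:
  fixes f :: "'b \<Rightarrow> real"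
  assumes "finite I" "\<And>i. i \<in> I \<Longrightarrow> finite (A i)" "\<And>x. f x \<ge> 0"
  shows "sum f (\<Union>i\<in>I. A i) \<le> (\<Sum>i\<in>I. sum f (A i))"
  using assms
proof (induction I rule: finite_induct)
  case (insert i I)
  have "sum f (A i \<union> (\<Union>i\<in>I. A i)) \<le> sum f (A i) + sum f (\<Union>i\<in>I. A i)"
    using insert by (subst sum.union_inter[symmetric]) (auto intro!: sum_nonneg)
  thus ?case using insert by auto
qed auto

text \<open>The bound does not depend on N, so restricting Mertens' sum to the d prime to m changes
  it by a bounded amount.\<close>

lemma sum_mangoldt_noncoprime_le:
  assumes "m > 0"
  shows "(\<Sum>d | d \<in> {1..N} \<and> \<not> coprime d m. mangoldt d / real d)
           \<le> (\<Sum>q\<in>prime_factors m. ln (real q) / (real q - 1))"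
proof -
  have "(\<Sum>d | d \<in> {1..N} \<and> \<not> coprime d m. mangoldt d / real d :: real)
      \<le> (\<Sum>d\<in>(\<Union>q\<in>prime_factors m. {d. d \<in> {1..N} \<and> q dvd d}). mangoldt d / real d)"
  proof (rule sum_mono2)
    show "{d \<in> {1..N}. \<not> coprime d m} \<subseteq> (\<Union>q\<in>prime_factors m. {d. d \<in> {1..N} \<and> q dvd d})"
    proof safe
      fix d assume d: "d \<in> {1..N}" "\<not> coprime d m"
      then obtain q where "prime q" "q dvd d" "q dvd m"
        by (metis coprime_iff_gcd_eq_1 gcd_greatest_iff prime_factor_nat)
      thus "d \<in> (\<Union>q\<in>prime_factors m. {d. d \<in> {1..N} \<and> q dvd d})"
        using d assms by (auto simp: in_prime_factors_iff)
    qed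
  qed (auto simp: mangoldt_nonneg)
  also have "\<dots> \<le> (\<Sum>q\<in>prime_factors m. \<Sum>d | d \<in> {1..N} \<and> q dvd d. mangoldt d / real d)"
    by (rule sum_UN_le) (auto simp: mangoldt_nonneg)
  also have "\<dots> \<le> (\<Sum>q\<in>prime_factors m. ln (real q) / (real q - 1))"
    by (intro sum_mono sum_mangoldt_multiples_le) auto
  finally show ?thesis .
qed

lemma ln_le_2_sqrt: "x > 0 \<Longrightarrow> ln x \<le> 2 * sqrt x"
  using ln_le_minus_one[of "sqrt x"] by (simp add: ln_sqrt)

text \<open>Serves twice: for the proper prime powers in Mertens' sum, and for the primes q > Z in
  the final average.\<close>

lemma summable_ln_over_square: "summable (\<lambda>n. ln (real n) / real n ^ 2)"
proof (rule summable_comparison_test')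
  show "summable (\<lambda>n. 2 * real n powr (-3/2))"
    by (intro summable_mult) (simp add: summable_real_powr_iff)
  fix n :: nat assume n: "n \<ge> 1"
  have "ln (real n) / real n ^ 2 \<le> 2 * sqrt (real n) / real n ^ 2"
    using n by (intro divide_right_mono ln_le_2_sqrt) auto
  also have "\<dots> = 2 * (real n powr (1/2) / real n powr 2)"
    using n by (simp add: powr_half_sqrt powr_numeral)
  also have "\<dots> = 2 * real n powr (-3/2)" by (subst powr_diff [symmetric]) simp
  finally show "norm (ln (real n) / real n ^ 2) \<le> 2 * real n powr (-3/2)" using n by simp
qed

text \<open>Only powers with exponent at least 2 carry weight here, and each prime q contributes at
  most 2 (ln q) / q^2. This allows passing from \<open>mangoldt\<close> to primes.\<close>

lemma sum_mangoldt_nonprime_bounded: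
  obtains C where "\<And>N. (\<Sum>d | d \<in> {1..N} \<and> \<not> prime d. mangoldt d / real d) \<le> (C::real)"
proof
  fix N :: nat
  let ?Q = "{q. prime q \<and> q \<le> N}"
  let ?T = "{d. d \<in> {1..N} \<and> \<not> prime d \<and> mangoldt d \<noteq> (0::real)}"
  let ?I = "(\<lambda>(q,j). q ^ j) ` (?Q \<times> {2..N})"
  have "(\<Sum>d | d \<in> {1..N} \<and> \<not> prime d. mangoldt d / real d :: real) = (\<Sum>d\<in>?T. mangoldt d / real d)"
    by (rule sum.mono_neutral_right) auto
  also have "\<dots> \<le> (\<Sum>d\<in>?I. mangoldt d / real d)"
  proof (rule sum_mono2)
    show "?T \<subseteq> ?I"
    proof
      fix d assume d: "d \<in> ?T"
      then obtain p k where pk: "prime p" "k > 0" "d = p ^ k" using mangoldt_nonzeroE by blast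
      have "k \<noteq> 1" using d pk by auto
      moreover have "k < p ^ k" using prime_ge_2_nat[OF pk(1)] by (intro power_gt_expt) auto
      moreover have "p ^ 1 \<le> p ^ k" using pk by (intro power_increasing) (auto simp: Suc_le_eq prime_gt_0_nat)
      ultimately show "d \<in> ?I" using pk d by (intro image_eqI[of _ _ "(p,k)"]) auto
    qed
  qed (auto simp: mangoldt_nonneg)
  also have "\<dots> \<le> (\<Sum>(q,j)\<in>?Q \<times> {2..N}. mangoldt (q ^ j) / real (q ^ j))"
    by (rule order_trans[OF sum_image_le]) (auto simp: mangoldt_nonneg case_prod_unfold)
  also have "\<dots> = (\<Sum>q\<in>?Q. \<Sum>j=2..N. ln (real q) * (1 / real (q ^ j)))"
    by (subst sum.Sigma[symmetric]) (auto simp: mangoldt_primepow intro!: sum.cong)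
  also have "\<dots> \<le> (\<Sum>q\<in>?Q. 2 * (ln (real q) / real q ^ 2))"
  proof (rule sum_mono)
    fix q assume "q \<in> ?Q"
    hence q: "q \<ge> 2" using prime_ge_2_nat by auto
    have "(\<Sum>j=2..N. ln (real q) * (1 / real (q ^ j))) \<le> ln (real q) * (1 / (real q ^ 2 * (1 - 1 / real q)))"
      unfolding sum_distrib_left[symmetric] using q by (intro mult_left_mono sum_inverse_powers_le) auto
    also have "\<dots> \<le> ln (real q) * (1 / (real q ^ 2 * (1 / 2)))"
      using q by (intro mult_left_mono divide_left_mono mult_pos_pos) (auto simp: field_simps)
    finally show "(\<Sum>j=2..N. ln (real q) * (1 / real (q ^ j))) \<le> 2 * (ln (real q) / real q ^ 2)" by (simp add: mult.commute)
  qed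
  also have "\<dots> \<le> (\<Sum>q\<in>{..N}. 2 * (ln (real q) / real q ^ 2))"
  proof (rule sum_mono2)
    fix b assume "b \<in> {..N} - ?Q"
    show "0 \<le> 2 * (ln (real b) / (real b)\<^sup>2)"
      by (cases "b = 0") auto
  qed auto
  also have "\<dots> \<le> (\<Sum>q. 2 * (ln (real q) / real q ^ 2))"
  proof (rule sum_le_suminf)
    fix b
    show "0 \<le> 2 * (ln (real b) / (real b)\<^sup>2)"
      by (cases "b = 0") auto
  qed (use summable_mult[OF summable_ln_over_square, of 2] in auto)
  finally show "(\<Sum>d | d \<in> {1..N} \<and> \<not> prime d. mangoldt d / real d) \<le> (\<Sum>q. 2 * (ln (real q) / real q ^ 2))" .
qed

section \<open>Primes congruent to -1\<close>

text \<open>The k with q k = 1 (mod d) form one residue class modulo d, and each of the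
  \<open>N div d\<close> full blocks of length d in 1..N meets it.\<close>

lemma card_dvd_linear_ge:
  fixes d q N :: nat
  assumes "coprime d q" "d > 0" "q > 0"
  shows "N div d \<le> card {k \<in> {1..N}. d dvd q * k - 1}"
proof -
  obtain x where x: "[q * x = 1] (mod d)" using assms(1) cong_solve_coprime_nat[of q d] by (auto simp: coprime_commute)
  \<comment> \<open>The representative is taken in 1..d rather than 0..d-1, so that its shifts by
    \<open>j * d\<close> with j < \<open>N div d\<close> stay within 1..N.\<close>
  define k0 where "k0 = (if x mod d = 0 then d else x mod d)"
  have k0: "1 \<le> k0" "k0 \<le> d" using assms(2) by (auto simp: k0_def less_imp_le Suc_le_eq)
  have "[k0 = x] (mod d)" by (auto simp: k0_def cong_def)
  hence "[q * k0 = 1] (mod d)" using x cong_trans cong_scalar_left by blast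
  moreover have q1: "1 \<le> q * k0" using k0 assms(3) by (simp add: Suc_le_eq)
  ultimately have dvd: "d dvd q * k0 - 1" by (simp add: cong_altdef_nat)
  have "(\<lambda>j. k0 + j * d) ` {..<N div d} \<subseteq> {k \<in> {1..N}. d dvd q * k - 1}"
  proof safe
    fix j assume j: "j < N div d"
    have "k0 + j * d \<le> Suc j * d" using k0 by simp
    also have "\<dots> \<le> (N div d) * d" using j by (intro mult_right_mono) auto
    also have "\<dots> \<le> N" by (rule div_times_less_eq_dividend)
    finally show "k0 + j * d \<in> {1..N}" using k0 by auto
    have "q * (k0 + j * d) - 1 = (q * k0 - 1) + d * (q * j)"
      using q1 by (simp add: algebra_simps)
    thus "d dvd q * (k0 + j * d) - 1" using dvd by simp
  qed
  hence "card ((\<lambda>j. k0 + j * d) ` {..<N div d}) \<le> card {k \<in> {1..N}. d dvd q * k - 1}"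
    by (intro card_mono) auto
  moreover have "inj_on (\<lambda>j. k0 + j * d) {..<N div d}" using assms(2) by (auto simp: inj_on_def)
  ultimately show ?thesis by (simp add: card_image)
qed

text \<open>Chebyshev's theta function for the residue class -1 modulo q.\<close>

definition theta_neg1 :: "nat \<Rightarrow> nat \<Rightarrow> real" where
  "theta_neg1 q n = (\<Sum>p | p \<in> {1..n} \<and> prime p \<and> q dvd p + 1. ln (real p))"

lemma theta_neg1_mono: "a \<le> b \<Longrightarrow> theta_neg1 q a \<le> theta_neg1 q b"
  unfolding theta_neg1_def by (rule sum_mono2) auto

lemma sum_ln_linear_eq_sum_mangoldt:
  assumes "q \<ge> 2"
  shows "(\<Sum>k=1..N. ln (real (q * k - 1))) = (\<Sum>d=1..q*N. mangoldt d * real (card {k \<in> {1..N}. d dvd q * k - 1}))"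
proof -
  have "(\<Sum>k=1..N. ln (real (q * k - 1))) = (\<Sum>k=1..N. \<Sum>d | d \<in> {1..q*N} \<and> d dvd q * k - 1. mangoldt d)"
  proof (rule sum.cong)
    fix k assume k: "k \<in> {1..N}"
    have "2 * 1 \<le> q * k" using assms k by (intro mult_le_mono) auto
    hence pos: "q * k - 1 > 0" by simp
    have "q * k \<le> q * N" using k by simp
    hence "{d. d dvd q * k - 1} = {d. d \<in> {1..q*N} \<and> d dvd q * k - 1}"
    proof (intro equalityI subsetI)
      fix d assume "d \<in> {d. d dvd q * k - 1}"
      hence d: "d dvd q * k - 1" by simp
      have "d \<noteq> 0" using d pos by (intro notI) auto
      moreover have "d \<le> q * k - 1" using d pos by (rule dvd_imp_le)
      hence "d \<le> q * N" using \<open>q * k \<le> q * N\<close> by linarith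
      ultimately show "d \<in> {d. d \<in> {1..q*N} \<and> d dvd q * k - 1}"
        using d by simp
    qed auto
    thus "ln (real (q * k - 1)) = (\<Sum>d | d \<in> {1..q*N} \<and> d dvd q * k - 1. mangoldt d)"
      using mangoldt_sum[of "q * k - 1", where ?'a = real] pos by simp
  qed auto
  also have "\<dots> = (\<Sum>d=1..q*N. \<Sum>k | k \<in> {1..N} \<and> d dvd q * k - 1. mangoldt d)"
    by (rule sum.swap_restrict) auto
  finally show ?thesis by (simp add: mult.commute)
qed

text \<open>Compares the Mangoldt expansions of the logarithms of \<open>(q - 1) (2 q - 1) \<dots> (N q - 1)\<close> and \<open>N!\<close>.\<close>

lemma theta_neg1_dilate:
  assumes q: "prime q"
  shows "theta_neg1 q (q * N) \<le> theta_neg1 q N + 2 * real N * ln (real q)"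
proof -
  have q2: "q \<ge> 2" using q by (rule prime_ge_2_nat)
  let ?c = "\<lambda>d. card {k \<in> {1..N}. d dvd q * k - 1}"
  let ?P = "\<lambda>d. prime d \<and> N < d \<and> q dvd d + 1"
  let ?Q = "\<lambda>d. d \<in> {1..N} \<and> q dvd d"
  \<comment> \<open>The comparison holds for each d. If q divides d, then d divides no q k - 1, and
    the second term on the right pays for d in N!. Otherwise the count is at least
    \<open>N div d\<close>; and if d > N is a prime with d + 1 = q k, then \<open>N div d\<close> is
    0 while this k makes the count at least 1, which leaves room for ln d.\<close>
  have ptw: "mangoldt d * real (N div d) + (if ?P d then ln (real d) else 0)
      \<le> mangoldt d * real (?c d) + (if ?Q d then mangoldt d / real d * real N else 0)"
    if d: "d \<in> {1..q*N}" for d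
  proof (cases "q dvd d")
    case True
    have "\<not> ?P d"
    proof
      assume "?P d"
      hence "q dvd 1" using True dvd_add_right_iff by blast
      thus False using q2 by simp
    qed
    moreover have "mangoldt d * real (N div d) \<le> (if ?Q d then mangoldt d / real d * real N else 0)"
    proof (cases "d \<le> N")
      case le: True
      have "real (N div d) \<le> real N / real d"
        by (metis floor_divide_of_nat_eq of_int_floor_le of_int_of_nat_eq)
      hence "mangoldt d * real (N div d) \<le> mangoldt d * (real N / real d)"
        by (intro mult_left_mono mangoldt_nonneg)
      thus ?thesis using le True d by simp
    qed auto
    moreover have "0 \<le> mangoldt d * real (?c d)" by (simp add: mangoldt_nonneg)
    ultimately show ?thesis by (simp only: if_False)
  next
    case False
    hence cop: "coprime d q" using q prime_imp_coprime coprime_commute by blast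
    show ?thesis
    proof (cases "?P d")
      case True
      then obtain k where k: "d + 1 = q * k" by auto
      have "k \<in> {1..N}"
      proof -
        have "q * k < q * Suc N" using k d q2 by auto
        hence "k \<le> N" by (simp only: mult_less_cancel1 less_Suc_eq_le)
        moreover have "k \<noteq> 0" using k by (intro notI) simp
        ultimately show ?thesis by simp
      qed
      moreover have "d dvd q * k - 1" using k by (metis add_diff_cancel_right' dvd_refl)
      ultimately have "{k \<in> {1..N}. d dvd q * k - 1} \<noteq> {}" by blast
      hence "?c d \<ge> 1" by (simp add: Suc_le_eq card_gt_0_iff)
      hence "ln (real d) * 1 \<le> ln (real d) * real (?c d)" using d by (intro mult_left_mono) auto
      thus ?thesis using True False by simp
    next
      case nP: False
      have "mangoldt d * real (N div d) \<le> mangoldt d * real (?c d)"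
        using card_dvd_linear_ge[OF cop, of N] d q2 by (intro mult_left_mono mangoldt_nonneg) auto
      thus ?thesis using nP False by auto
    qed
  qed
  have 1: "(\<Sum>d=1..q*N. mangoldt d * real (N div d)) = ln (fact N)"
    unfolding ln_fact_eq_sum_mangoldt using q2 by (intro sum.mono_neutral_right) auto
  have 2: "(\<Sum>d=1..q*N. if ?P d then ln (real d) else 0) = theta_neg1 q (q * N) - theta_neg1 q N"
  proof -
    have "(\<Sum>d=1..q*N. if ?P d then ln (real d) else 0) = (\<Sum>d | d \<in> {1..q*N} \<and> ?P d. ln (real d))"
      by (rule sum.inter_filter[symmetric]) auto
    moreover have "theta_neg1 q (q * N) = theta_neg1 q N + (\<Sum>d | d \<in> {1..q*N} \<and> ?P d. ln (real d))"
    proof -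
      have "{p. p \<in> {1..M} \<and> prime p \<and> q dvd p + 1} =
          {p. p \<in> {1..N} \<and> prime p \<and> q dvd p + 1} \<union> {d. d \<in> {1..M} \<and> ?P d}" if "N \<le> M" for M
        using that by auto
      from this[of "q * N"] have "{p. p \<in> {1..q*N} \<and> prime p \<and> q dvd p + 1} =
          {p. p \<in> {1..N} \<and> prime p \<and> q dvd p + 1} \<union> {d. d \<in> {1..q*N} \<and> ?P d}" using q2 by simp
      thus ?thesis unfolding theta_neg1_def by (simp only:) (rule sum.union_disjoint, auto)
    qed
    ultimately show ?thesis by simp
  qed
  \<comment> \<open>Each of the next two facts costs N ln q: here through q k - 1 <= q k, then
    through the powers of q up to N, which divide no q k - 1.\<close>
  have 3: "(\<Sum>d=1..q*N. mangoldt d * real (?c d)) \<le> real N * ln (real q) + ln (fact N)"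
  proof -
    have "(\<Sum>d=1..q*N. mangoldt d * real (?c d)) = (\<Sum>k=1..N. ln (real (q * k - 1)))"
      using sum_ln_linear_eq_sum_mangoldt[OF q2] by simp
    also have "\<dots> \<le> (\<Sum>k=1..N. ln (real q) + ln (real k))"
    proof (rule sum_mono)
      fix k assume k: "k \<in> {1..N}"
      have "2 * 1 \<le> q * k" using q2 k by (intro mult_le_mono) auto
      hence "0 < q * k - 1" "q * k - 1 \<le> q * k" by linarith+
      hence "ln (real (q * k - 1)) \<le> ln (real (q * k))"
        using ln_mono[of "real (q * k - 1)" "real (q * k)"] by (simp only: of_nat_le_iff of_nat_0_less_iff)
      also have "\<dots> = ln (real q) + ln (real k)" using k q2 by (simp add: ln_mult)
      finally show "ln (real (q * k - 1)) \<le> ln (real q) + ln (real k)" .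
    qed
    also have "\<dots> = real N * ln (real q) + ln (fact N)"
      unfolding fact_prod of_nat_prod by (subst ln_prod) (auto simp: sum.distrib)
    finally show ?thesis .
  qed
  have 4: "(\<Sum>d=1..q*N. if ?Q d then mangoldt d / real d * real N else 0) \<le> real N * ln (real q)"
  proof -
    have "(\<Sum>d=1..q*N. if ?Q d then mangoldt d / real d * real N else 0)
        = (\<Sum>d | d \<in> {1..q*N} \<and> ?Q d. mangoldt d / real d * real N)"
      by (rule sum.inter_filter[symmetric]) auto
    also have "{d. d \<in> {1..q*N} \<and> ?Q d} = {d. d \<in> {1..N} \<and> q dvd d}"
    proof -
      have "{d. d \<in> {1..M} \<and> ?Q d} = {d. d \<in> {1..N} \<and> q dvd d}" if "N \<le> M" for M
        using that by auto
      thus ?thesis using q2 by simp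
    qed
    also have "(\<Sum>d | d \<in> {1..N} \<and> q dvd d. mangoldt d / real d * real N) \<le> ln (real q) / (real q - 1) * real N"
      unfolding sum_distrib_right[symmetric] by (intro mult_right_mono sum_mangoldt_multiples_le[OF q]) auto
    also have "\<dots> \<le> ln (real q) / 1 * real N"
      using q2 by (intro mult_right_mono divide_left_mono) auto
    finally show ?thesis by (simp add: mult.commute)
  qed
  have "(\<Sum>d=1..q*N. mangoldt d * real (N div d) + (if ?P d then ln (real d) else 0))
      \<le> (\<Sum>d=1..q*N. mangoldt d * real (?c d) + (if ?Q d then mangoldt d / real d * real N else 0))"
    by (intro sum_mono ptw)
  thus ?thesis unfolding sum.distrib 1 2 using 3 4 by linarith
qed

text \<open>The dilation step is iterated with N = n/q rounded up, where N <= 2 n / q. A constant C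
  survives if 2 (C / q + 2) <= C; for q = 3 the least solution is C = 12, for q = 2 there is
  none.\<close>

lemma theta_neg1_le:
  assumes q: "prime q" "q \<ge> 3"
  shows "theta_neg1 q n \<le> 12 * real n * ln (real q) / real q"
proof (induction n rule: less_induct)
  case (less n)
  show ?case
  \<comment> \<open>Since q divides p + 1, no p lies below q - 1. For n >= q - 1 rounding up costs
    at most a factor 2, as q N <= n + q - 1 <= 2 n.\<close>
  proof (cases "n + 1 < q \<or> n \<le> 1")
    case True
    have "{p. p \<in> {1..n} \<and> prime p \<and> q dvd p + 1} = {}"
      using True by (auto dest: dvd_imp_le simp: not_prime_1 le_Suc_eq)
    hence "theta_neg1 q n = 0" unfolding theta_neg1_def by (simp only: sum.empty)
    thus ?thesis using q by simp
  next
    case False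
    define N where "N = (n + q - 1) div q"
    have q0: "q > 0" using q by simp
    have "n + q - 1 < q * Suc N" unfolding N_def using dividend_less_times_div[OF q0, of "n + q - 1"] by simp
    hence nN: "n \<le> q * N" using q0 by simp
    have Nn: "q * N \<le> 2 * n" unfolding N_def using times_div_less_eq_dividend[of q "n+q-1"] False by linarith
    have "3 * N \<le> q * N" using q by (intro mult_right_mono) auto
    hence "N < n" using Nn False by linarith
    have l0: "ln (real q) \<ge> 0" using q by simp
    have "real q * real N \<le> 2 * real n"
      using Nn by (metis of_nat_le_iff of_nat_mult of_nat_numeral)
    hence rN: "real N \<le> 2 * real n / real q" using q0 by (simp add: field_simps)
    have "theta_neg1 q n \<le> theta_neg1 q (q * N)" using nN by (rule theta_neg1_mono)
    also have "\<dots> \<le> theta_neg1 q N + 2 * real N * ln (real q)" by (rule theta_neg1_dilate[OF q(1)])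
    also have "\<dots> \<le> 12 * real N * ln (real q) / real q + 2 * real N * ln (real q)"
      using less.IH[OF \<open>N < n\<close>] by simp
    also have "\<dots> = real N * (ln (real q) * (12 / real q + 2))" using q0 by (simp add: field_simps)
    also have "\<dots> \<le> (2 * real n / real q) * (ln (real q) * 6)"
    proof (intro mult_mono rN)
      have "12 / real q \<le> 4" using q by (simp add: divide_simps)
      thus "12 / real q + 2 \<le> 6" by simp
    qed (use l0 q0 in auto)
    finally show ?thesis by simp
  qed
qed

text \<open>Partial summation against \<open>theta_neg1\<close>. In 2 + ln N, one 1 is the boundary
  term and the other comes from replacing ln (N + 1) by ln N.\<close>

lemma sum_ln_over_prime_neg1_le:
  assumes q: "prime q" "q \<ge> 3" and N: "N > 0"
  shows "(\<Sum>p | p \<in> {1..N} \<and> prime p \<and> q dvd p + 1. ln (real p) / real p)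
           \<le> 12 * ln (real q) / real q * (2 + ln (real N))"
proof -
  let ?C = "12 * ln (real q) / real q"
  let ?W = "\<lambda>N. \<Sum>p | p \<in> {1..N} \<and> prime p \<and> q dvd p + 1. ln (real p) / real p"
  have step: "(\<Sum>p | p \<in> {1..Suc N} \<and> prime p \<and> q dvd p + 1. f p)
      = (\<Sum>p | p \<in> {1..N} \<and> prime p \<and> q dvd p + 1. f p) + (if prime (Suc N) \<and> q dvd Suc N + 1 then f (Suc N) else 0)"
    for f :: "nat \<Rightarrow> real" and N
  proof -
    have "(\<Sum>p | p \<in> {1..N} \<and> prime p \<and> q dvd p + 1. f p) = (\<Sum>p=1..N. if prime p \<and> q dvd p + 1 then f p else 0)" for N
      by (rule sum.inter_filter) auto
    thus ?thesis by simp
  qed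
  have eq: "?W N = theta_neg1 q N / real (Suc N) + (\<Sum>n=1..N. theta_neg1 q n / (real n * real (Suc n)))" for N
  proof (induction N)
    case 0
    show ?case by (simp add: theta_neg1_def)
  next
    case (Suc N)
    define x where "x = (if prime (Suc N) \<and> q dvd Suc N + 1 then ln (real (Suc N)) else 0)"
    have th: "theta_neg1 q (Suc N) = theta_neg1 q N + x"
      unfolding theta_neg1_def step x_def ..
    have "?W (Suc N) = ?W N + x / real (Suc N)" unfolding step x_def by simp
    also have "\<dots> = theta_neg1 q N / real (Suc N) + (\<Sum>n=1..N. theta_neg1 q n / (real n * real (Suc n))) + x / real (Suc N)"
      using Suc by simp
    also have "\<dots> = theta_neg1 q (Suc N) / real (Suc N) + (\<Sum>n=1..N. theta_neg1 q n / (real n * real (Suc n)))"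
      unfolding th by (simp add: add_divide_distrib)
    also have "theta_neg1 q (Suc N) / real (Suc N) = theta_neg1 q (Suc N) / real (Suc (Suc N))
        + theta_neg1 q (Suc N) / (real (Suc N) * real (Suc (Suc N)))"
    proof -
      have "y / a = y / (a + 1) + y / (a * (a + 1))" if "a > 0" for a y :: real
        using that by (simp add: divide_simps) (simp add: algebra_simps)
      from this[of "real (Suc N)"] show ?thesis by (simp add: add.commute)
    qed
    finally show ?case by simp
  qed
  have C0: "?C \<ge> 0" using q by simp
  have th: "theta_neg1 q n \<le> ?C * real n" for n
    using theta_neg1_le[OF q, of n] by (simp add: mult_ac)
  have lnsum: "(\<Sum>n=1..N. 1 / real (Suc n)) \<le> ln (real (Suc N))" for N
  proof (induction N)
    case (Suc N)
    have "ln (real (Suc N) / real (Suc (Suc N))) \<le> real (Suc N) / real (Suc (Suc N)) - 1"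
      by (rule ln_le_minus_one) simp
    also have "\<dots> = - (1 / real (Suc (Suc N)))" by (simp add: field_simps)
    also have "ln (real (Suc N) / real (Suc (Suc N))) = ln (real (Suc N)) - ln (real (Suc (Suc N)))"
      by (simp add: ln_div del: of_nat_Suc)
    finally have "1 / real (Suc (Suc N)) \<le> ln (real (Suc (Suc N))) - ln (real (Suc N))" by linarith
    thus ?case using Suc by simp
  qed auto
  have "?W N \<le> ?C * 1 + (\<Sum>n=1..N. ?C * (1 / real (Suc n)))"
    unfolding eq
  proof (intro add_mono sum_mono)
    have "theta_neg1 q N / real (Suc N) \<le> ?C * real N / real (Suc N)" by (intro divide_right_mono th) auto
    also have "\<dots> = ?C * (real N / real (Suc N))" by simp
    also have "\<dots> \<le> ?C * 1" using C0 by (intro mult_left_mono) auto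
    finally show "theta_neg1 q N / real (Suc N) \<le> ?C * 1" .
    fix n assume n: "n \<in> {1..N}"
    have "theta_neg1 q n / (real n * real (Suc n)) \<le> ?C * real n / (real n * real (Suc n))"
      by (intro divide_right_mono th) auto
    also have "\<dots> = ?C * (1 / real (Suc n))" using n by simp
    finally show "theta_neg1 q n / (real n * real (Suc n)) \<le> ?C * (1 / real (Suc n))" .
  qed
  also have "\<dots> = ?C * (1 + (\<Sum>n=1..N. 1 / real (Suc n)))" by (simp only: sum_distrib_left distrib_left)
  also have "\<dots> \<le> ?C * (2 + ln (real N))"
  proof (rule mult_left_mono[OF _ C0])
    have "ln (real (Suc N) / real N) \<le> real (Suc N) / real N - 1" using N by (intro ln_le_minus_one) auto
    also have "\<dots> \<le> 1" using N by (simp add: field_simps)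
    also have "ln (real (Suc N) / real N) = ln (real (Suc N)) - ln (real N)" using N by (simp add: ln_div del: of_nat_Suc)
    finally show "1 + (\<Sum>n=1..N. 1 / real (Suc n)) \<le> 2 + ln (real N)" using lnsum[of N] by linarith
  qed
  finally show ?thesis .
qed

section \<open>Dirichlet characters of squarefree modulus\<close>

text \<open>The letter \<open>\<eta>\<close> is used for characters since \<open>\<chi>\<close> is the vector binder of HOL-Analysis.\<close>

definition dchar :: "nat \<Rightarrow> (nat \<Rightarrow> complex) \<Rightarrow> bool" where
  "dchar m \<eta> \<longleftrightarrow> \<eta> 1 = 1 \<and> (\<forall>a b. \<eta> (a * b) = \<eta> a * \<eta> b) \<and>
     (\<forall>n. \<eta> n = 0 \<longleftrightarrow> \<not> coprime n m) \<and> (\<forall>a b. [a = b] (mod m) \<longrightarrow> \<eta> a = \<eta> b)"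

definition principal_dchar :: "nat \<Rightarrow> nat \<Rightarrow> complex" where
  "principal_dchar m n = (if coprime n m then 1 else 0)"

lemma dchar_1: "dchar m \<eta> \<Longrightarrow> \<eta> (Suc 0) = 1"
  and dchar_mult: "dchar m \<eta> \<Longrightarrow> \<eta> (a * b) = \<eta> a * \<eta> b"
  and dchar_eq_0_iff: "dchar m \<eta> \<Longrightarrow> \<eta> n = 0 \<longleftrightarrow> \<not> coprime n m"
  and dchar_cong: "dchar m \<eta> \<Longrightarrow> [a = b] (mod m) \<Longrightarrow> \<eta> a = \<eta> b"
  unfolding dchar_def by simp_all

lemma dchar_mod: "dchar m \<eta> \<Longrightarrow> \<eta> (n mod m) = \<eta> n"
  by (rule dchar_cong) auto

lemma dchar_power: "dchar m \<eta> \<Longrightarrow> \<eta> (n ^ k) = \<eta> n ^ k"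
  by (induction k) (auto simp: dchar_1 dchar_mult)

lemma dchar_principal: "m > 0 \<Longrightarrow> dchar m (principal_dchar m)"
  using coprime_cong_cong_left[of _ _ m] by (auto simp: dchar_def principal_dchar_def)

lemma dchar_times: "dchar m \<eta> \<Longrightarrow> dchar m \<psi> \<Longrightarrow> dchar m (\<lambda>n. \<eta> n * \<psi> n)"
  by (auto simp: dchar_def)

lemma dchar_cnj: "dchar m \<eta> \<Longrightarrow> dchar m (\<lambda>n. cnj (\<eta> n))"
  by (auto simp: dchar_def)

lemma dchar_power_totient:
  assumes "dchar m \<eta>" "coprime n m"
  shows "\<eta> n ^ totient m = 1"
proof -
  have "[n ^ totient m = 1] (mod m)" using assms by (intro euler_theorem) auto
  hence "\<eta> (n ^ totient m) = \<eta> 1" using assms(1) by (intro dchar_cong)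
  thus ?thesis using assms(1) by (simp add: dchar_power dchar_1)
qed

lemma norm_dchar:
  assumes "dchar m \<eta>" "m > 0"
  shows "norm (\<eta> n) = (if coprime n m then 1 else 0)"
proof (cases "coprime n m")
  case True
  hence "norm (\<eta> n) = 1 \<or> totient m = 0"
    by (intro power_eq_1_iff dchar_power_totient[OF assms(1)])
  thus ?thesis using True assms(2) by simp
qed (use assms in \<open>auto simp: dchar_eq_0_iff\<close>)

lemma norm_dchar_le_1: "dchar m \<eta> \<Longrightarrow> m > 0 \<Longrightarrow> norm (\<eta> n) \<le> 1"
  by (simp add: norm_dchar)

text \<open>A character is determined by its values on 0..m-1, each of which is 0 or a root of unity
  of order dividing \<open>totient m\<close>.\<close>

lemma finite_dchars:
  assumes "m > 0"
  shows "finite {\<eta>. dchar m \<eta>}"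
proof (rule finite_subset)
  let ?F = "PiE {..<m} (\<lambda>_. insert 0 {z::complex. z ^ totient m = 1})"
  show "{\<eta>. dchar m \<eta>} \<subseteq> (\<lambda>f n. f (n mod m)) ` ?F"
  proof
    fix \<eta> assume "\<eta> \<in> {\<eta>. dchar m \<eta>}"
    hence \<eta>: "dchar m \<eta>" by simp
    have "restrict \<eta> {..<m} \<in> ?F"
      using \<eta> by (auto simp: dchar_eq_0_iff dchar_power_totient)
    moreover have "\<eta> = (\<lambda>n. restrict \<eta> {..<m} (n mod m))"
      using assms \<eta> by (auto simp: dchar_mod)
    ultimately show "\<eta> \<in> (\<lambda>f n. f (n mod m)) ` ?F" by blast
  qed
  show "finite ((\<lambda>f n. f (n mod m)) ` ?F)"
    using assms by (intro finite_imageI finite_PiE) (auto intro!: finite_nth_roots)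
qed

lemma sum_dchar_period:
  assumes "dchar m \<eta>" "\<eta> \<noteq> principal_dchar m" "m > 0"
  shows "(\<Sum>n<m. \<eta> n) = 0"
proof -
  obtain a where a: "\<eta> a \<noteq> principal_dchar m a" using assms(2) by blast
  have cop: "coprime a m" using a assms(1) by (auto simp: principal_dchar_def dchar_eq_0_iff split: if_splits)
  have ne: "\<eta> a \<noteq> 1" using a cop by (auto simp: principal_dchar_def)
  have inj: "inj_on (\<lambda>n. a * n mod m) {..<m}"
  proof (rule inj_onI)
    fix x y assume xy: "x \<in> {..<m}" "y \<in> {..<m}" "a * x mod m = a * y mod m"
    hence "[a * x = a * y] (mod m)" by (simp add: cong_def)
    hence "[x = y] (mod m)" using cop by (simp add: cong_mult_lcancel_nat)
    thus "x = y" using xy by (simp add: cong_def)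
  qed
  have "bij_betw (\<lambda>n. a * n mod m) {..<m} {..<m}"
    using inj assms(3) by (intro bij_betw_imageI endo_inj_surj) auto
  hence "(\<Sum>n<m. \<eta> n) = (\<Sum>n<m. \<eta> (a * n mod m))"
    by (rule sum.reindex_bij_betw[symmetric])
  also have "\<dots> = \<eta> a * (\<Sum>n<m. \<eta> n)"
    by (simp add: dchar_mod[OF assms(1)] dchar_mult[OF assms(1)] sum_distrib_left)
  finally show ?thesis using ne by (metis mult_cancel_right1)
qed

lemma norm_sum_dchar_le:
  assumes "dchar m \<eta>" "\<eta> \<noteq> principal_dchar m" "m > 0"
  shows "norm (\<Sum>n<K. \<eta> n) \<le> real m"
proof -
  have per: "\<eta> (k * m + n) = \<eta> n" for k n
    by (rule dchar_cong[OF assms(1)]) (auto simp: cong_def)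
  have block: "(\<Sum>n\<in>{k*m..<k*m+r}. \<eta> n) = (\<Sum>n<r. \<eta> n)" for k r
  proof -
    have "(\<Sum>n\<in>{k*m..<k*m+r}. \<eta> n) = (\<Sum>n<r. \<eta> (k * m + n))"
      by (rule sum.reindex_bij_witness[of _ "\<lambda>n. k * m + n" "\<lambda>n. n - k * m"]) auto
    thus ?thesis by (simp add: per)
  qed
  define q r where "q = K div m" and "r = K mod m"
  have K: "K = q * m + r" and r: "r < m" using assms(3) by (auto simp: q_def r_def)
  have "(\<Sum>n<K. \<eta> n) = (\<Sum>n<q*m. \<eta> n) + (\<Sum>n\<in>{q*m..<q*m+r}. \<eta> n)"
    unfolding K by (subst sum.union_disjoint[symmetric]) (auto intro: sum.cong)
  also have "(\<Sum>n<q*m. \<eta> n) = 0"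
    by (subst sum.nat_group[symmetric]) (simp add: block sum_dchar_period[OF assms])
  finally have "(\<Sum>n<K. \<eta> n) = (\<Sum>n<r. \<eta> n)" by (simp add: block)
  also have "norm \<dots> \<le> (\<Sum>n<r. 1)"
    by (rule sum_norm_le) (use norm_dchar_le_1[OF assms(1,3)] in auto)
  finally show ?thesis using r by simp
qed

lemma prod_prime_factors_squarefree:
  assumes "squarefree (m::nat)"
  shows "\<Prod>(prime_factors m) = m"
proof -
  have m: "m \<noteq> 0" using assms by (metis not_squarefree_0)
  have "m = (\<Prod>p\<in>prime_factors m. p ^ multiplicity p m)"
    using m by (intro prime_factorization_nat) auto
  also have "\<dots> = (\<Prod>p\<in>prime_factors m. p)"
  proof (rule prod.cong)
    fix p assume "p \<in> prime_factors m"
    hence "multiplicity p m = 1"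
      using assms m by (auto simp: squarefree_factorial_semiring')
    thus "p ^ multiplicity p m = p" by simp
  qed auto
  finally show ?thesis ..
qed

lemma squarefree_cong:
  fixes x y m :: nat
  assumes "squarefree m" "\<And>r. prime r \<Longrightarrow> r dvd m \<Longrightarrow> [x = y] (mod r)"
  shows "[x = y] (mod m)"
proof -
  have "[x = y] (mod (\<Prod>p\<in>prime_factors m. p))"
    by (rule coprime_cong_prod_nat) (use assms(2) in \<open>auto intro: primes_coprime\<close>)
  thus ?thesis using prod_prime_factors_squarefree[OF assms(1)] by simp
qed

text \<open>As m is squarefree, n differs from 1 modulo some prime r dividing m. Sending the power
  g^i of a primitive root g modulo r to \<zeta>^i, with \<zeta> a primitive root of unity of order r
  - 1, is injective on the units modulo r; cut off at integers not prime to m it is a character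
  modulo m.\<close>

lemma exists_separating_dchar:
  assumes "squarefree m" "coprime n m" "\<not> [n = 1] (mod m)"
  obtains \<eta> where "dchar m \<eta>" "\<eta> n \<noteq> 1"
proof -
  have m: "m > 0" using assms(1) by (metis not_squarefree_0 bot_nat_0.not_eq_extremum)
  obtain r where r: "prime r" "r dvd m" "\<not> [n = 1] (mod r)"
    using squarefree_cong[of m n 1] assms by blast
  have r1: "r > 1" using prime_gt_1_nat[OF r(1)] .
  obtain g where g: "residue_primroot r g" using prime_primitive_root_exists[OF r1 r(1)] by blast
  have ordg: "ord r g = r - 1" and copg: "coprime r g"
    using g r(1) by (auto simp: residue_primroot_def totient_prime)
  \<comment> \<open>A discrete logarithm. It is determined only modulo r - 1, which is enough
    because \<zeta> has order r - 1.\<close>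
  define ind where "ind k = (SOME i. [g ^ i = k] (mod r))" for k
  have ind: "[g ^ ind k = k] (mod r)" if "coprime k r" for k
  proof -
    have "k mod r \<in> totatives r"
      using that r1 by (auto simp: totatives_def intro!: Nat.gr0I)
    then obtain i where "k mod r = g ^ i mod r"
      using residue_primroot_is_generator[OF r1 g] by (auto simp: bij_betw_def)
    hence "[g ^ i = k] (mod r)" by (simp add: cong_def)
    thus ?thesis unfolding ind_def by (rule someI)
  qed
  have cop: "coprime k r" if "coprime k m" for k
    using that r(2) by (meson coprime_divisors dvd_refl)
  define \<zeta> where "\<zeta> = exp (2 * of_real pi * \<i> / of_nat (r - 1))"
  have \<zeta>_eq: "\<zeta> ^ i = 1 \<longleftrightarrow> (r - 1) dvd i" for i
  proof -
    have "\<zeta> ^ i = exp (2 * of_real pi * \<i> * of_nat i / of_nat (r - 1))"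
      unfolding \<zeta>_def exp_of_nat_mult[symmetric] by (simp add: field_simps)
    thus ?thesis using complex_root_unity_eq_1[of "r-1" i] r1 by simp
  qed
  have \<zeta>_cong: "\<zeta> ^ i = \<zeta> ^ j" if "[i = j] (mod (r - 1))" for i j
    using that
  proof (induction i j rule: linorder_wlog)
    case (le i j)
    hence "(r - 1) dvd (j - i)" using cong_altdef_nat[of i j "r - 1"] by (simp add: cong_sym_eq)
    hence "\<zeta> ^ (j - i) = 1" by (simp add: \<zeta>_eq)
    thus ?case using le by (metis mult_1_right power_add le_add_diff_inverse)
  next
    case (sym i j) thus ?case by (metis cong_sym)
  qed
  have ind_eq: "[ind k = i] (mod (r - 1))" if "coprime k r" "[g ^ i = k] (mod r)" for k i
  proof -
    have "[g ^ ind k = g ^ i] (mod r)" using ind[OF that(1)] that(2) by (metis cong_sym cong_trans)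
    thus ?thesis using order_divides_expdiff[OF copg] ordg by simp
  qed
  define \<eta> where "\<eta> k = (if coprime k m then \<zeta> ^ ind k else 0)" for k
  have \<zeta>0: "\<zeta> \<noteq> 0" by (simp add: \<zeta>_def)
  have "dchar m \<eta>"
    unfolding dchar_def
  proof (intro conjI allI impI)
    show "\<eta> 1 = 1"
      using ind_eq[of 1 0] \<zeta>_cong[of "ind 1" 0] by (simp add: \<eta>_def)
    show "\<eta> (a * b) = \<eta> a * \<eta> b" for a b
    proof (cases "coprime a m \<and> coprime b m")
      case True
      have "[g ^ (ind a + ind b) = a * b] (mod r)"
        unfolding power_add using True by (intro cong_mult ind cop) auto
      hence "[ind (a * b) = ind a + ind b] (mod (r - 1))"
        using True by (intro ind_eq cop) auto
      thus ?thesis using True \<zeta>_cong[of "ind (a * b)" "ind a + ind b"] by (simp add: \<eta>_def power_add)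
    qed (auto simp: \<eta>_def)
    show "\<eta> k = 0 \<longleftrightarrow> \<not> coprime k m" for k using \<zeta>0 by (auto simp: \<eta>_def)
    fix a b assume ab: "[a = b] (mod m)"
    have "coprime a m \<longleftrightarrow> coprime b m"
      using ab by (metis cong_imp_coprime cong_sym)
    moreover have "\<zeta> ^ ind a = \<zeta> ^ ind b" if "coprime a m" "coprime b m"
    proof (rule \<zeta>_cong, rule ind_eq)
      show "coprime a r" using that cop by auto
      have "[b = a] (mod r)" using ab r(2) by (metis cong_dvd_modulus_nat cong_sym)
      thus "[g ^ ind b = a] (mod r)" using ind[OF cop[OF that(2)]] cong_trans by blast
    qed
    ultimately show "\<eta> a = \<eta> b" by (auto simp: \<eta>_def)
  qed
  moreover have "\<eta> n \<noteq> 1"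
  proof
    assume "\<eta> n = 1"
    hence "ord r g dvd ind n" using assms(2) by (simp add: \<eta>_def \<zeta>_eq ordg)
    hence "[g ^ ind n = 1] (mod r)" by (simp add: ord_divides')
    hence "[n = 1] (mod r)" using ind[OF cop[OF assms(2)]] by (metis cong_sym cong_trans)
    thus False using r(3) by simp
  qed
  ultimately show ?thesis using that by blast
qed

text \<open>Multiplication by a character \<psi> with \<psi> n \<noteq> 1 permutes the characters
  and multiplies the sum by \<psi> n. It is injective because all characters vanish wherever \<psi>
  cannot be cancelled.\<close>

lemma sum_dchars_eq_0:
  assumes "squarefree m" "\<not> [n = 1] (mod m)"
  shows "(\<Sum>\<eta> | dchar m \<eta>. \<eta> n) = 0"
proof (cases "coprime n m")
  case True
  have m: "m > 0" using assms(1) by (metis not_squarefree_0 bot_nat_0.not_eq_extremum)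
  obtain \<psi> where \<psi>: "dchar m \<psi>" "\<psi> n \<noteq> 1"
    using exists_separating_dchar[OF assms(1) True assms(2)] by blast
  let ?f = "\<lambda>\<eta> k. \<psi> k * \<eta> k"
  have inj: "inj_on ?f {\<eta>. dchar m \<eta>}"
  proof (rule inj_onI, rule ext)
    fix \<eta> \<eta>' k assume *: "\<eta> \<in> {\<eta>. dchar m \<eta>}" "\<eta>' \<in> {\<eta>. dchar m \<eta>}" "?f \<eta> = ?f \<eta>'"
    hence "\<psi> k * \<eta> k = \<psi> k * \<eta>' k" by meson
    thus "\<eta> k = \<eta>' k" using * \<psi>(1) dchar_eq_0_iff by (metis mem_Collect_eq mult_left_cancel)
  qed
  have "bij_betw ?f {\<eta>. dchar m \<eta>} {\<eta>. dchar m \<eta>}"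
    using inj finite_dchars[OF m] dchar_times[OF \<psi>(1)] by (intro bij_betw_imageI endo_inj_surj) auto
  hence "(\<Sum>\<eta> | dchar m \<eta>. \<eta> n) = (\<Sum>\<eta> | dchar m \<eta>. ?f \<eta> n)"
    by (rule sum.reindex_bij_betw[symmetric])
  also have "\<dots> = \<psi> n * (\<Sum>\<eta> | dchar m \<eta>. \<eta> n)" by (simp add: sum_distrib_left)
  finally show ?thesis using \<psi>(2) by (metis mult_cancel_right1)
qed (auto intro!: sum.neutral simp: dchar_eq_0_iff)

lemma card_coprime_less:
  assumes "m > 1"
  shows "card {n. n < m \<and> coprime n m} = totient m"
proof -
  have "{n. n < m \<and> coprime n m} = totatives m"
    using assms by (auto simp: totatives_def intro!: Nat.gr0I le_neq_implies_less)
  thus ?thesis by (simp add: totient_def)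
qed

text \<open>\<eta> n is summed over all \<eta> and all n < m in both orders: only n = 1 contributes,
  giving the number of characters, and only the principal character contributes, giving
  \<open>totient m\<close>.\<close>

lemma card_dchars:
  assumes "squarefree m" "m > 1"
  shows "card {\<eta>. dchar m \<eta>} = totient m"
proof -
  have m: "m > 0" using assms by simp
  have "of_nat (card {\<eta>. dchar m \<eta>}) = (\<Sum>\<eta> | dchar m \<eta>. \<eta> 1)"
    by (simp add: dchar_1)
  also have "\<dots> = (\<Sum>n<m. \<Sum>\<eta> | dchar m \<eta>. \<eta> n)"
  proof -
    have "(\<Sum>\<eta> | dchar m \<eta>. \<eta> n) = 0" if "n < m" "n \<noteq> 1" for n
      using that assms by (intro sum_dchars_eq_0) (auto simp: cong_def)
    hence "(\<Sum>n<m. \<Sum>\<eta> | dchar m \<eta>. \<eta> n) = (\<Sum>n\<in>{1}. \<Sum>\<eta> | dchar m \<eta>. \<eta> n)"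
      using assms(2) by (intro sum.mono_neutral_right) auto
    thus ?thesis by simp
  qed
  also have "\<dots> = (\<Sum>\<eta> | dchar m \<eta>. \<Sum>n<m. \<eta> n)" by (rule sum.swap)
  also have "\<dots> = (\<Sum>\<eta>\<in>{principal_dchar m}. \<Sum>n<m. \<eta> n)"
    using sum_dchar_period[OF _ _ m] dchar_principal[OF m] finite_dchars[OF m]
    by (intro sum.mono_neutral_right) auto
  also have "\<dots> = (\<Sum>n | n < m \<and> coprime n m. 1)"
    by (simp add: principal_dchar_def sum.If_cases Int_def)
  also have "\<dots> = of_nat (totient m)" using card_coprime_less[OF assms(2)] by simp
  finally show ?thesis by (metis of_nat_eq_iff)
qed

lemma sum_dchars:
  assumes "squarefree m" "m > 1"
  shows "(\<Sum>\<eta> | dchar m \<eta>. \<eta> n) = (if [n = 1] (mod m) then of_nat (totient m) else 0)"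
proof (cases "[n = 1] (mod m)")
  case True
  have "(\<Sum>\<eta> | dchar m \<eta>. \<eta> n) = (\<Sum>\<eta> | dchar m \<eta>. 1)"
    by (rule sum.cong, simp) (use True dchar_cong dchar_1 in \<open>metis One_nat_def mem_Collect_eq\<close>)
  thus ?thesis using True card_dchars[OF assms] by simp
qed (simp add: sum_dchars_eq_0[OF assms(1)])

section \<open>The L-function at 1\<close>

definition moebius_mu :: "nat \<Rightarrow> real" where
  "moebius_mu n = (if squarefree n then (-1) ^ card (prime_factors n) else 0)"

lemma abs_moebius_le: "\<bar>moebius_mu n\<bar> \<le> 1"
  by (simp add: moebius_mu_def power_abs)

lemma prod_prime_factors_dvd: "n > 0 \<Longrightarrow> \<Prod>(prime_factors n) dvd (n::nat)"
proof -
  assume n: "n > 0"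
  have "(\<Prod>p\<in>prime_factors n. p) dvd (\<Prod>p\<in>prime_factors n. p ^ multiplicity p n)"
    by (intro prod_dvd_prod dvd_power) (auto simp: prime_factors_multiplicity)
  also have "\<dots> = n" using n by (intro prime_factorization_nat[symmetric]) auto
  finally show ?thesis .
qed

text \<open>Squarefree divisors of n are the products of sets of its prime factors, so the sum
  expands the product of 1 - 1 over the prime factors of n.\<close>

lemma sum_moebius_divisors:
  assumes "n > 0"
  shows "(\<Sum>d | d dvd n. moebius_mu d) = (if n = 1 then 1 else 0)"
proof -
  have "(\<Sum>d | d dvd n. moebius_mu d) = (\<Sum>d | d dvd n \<and> squarefree d. (-1) ^ card (prime_factors d))"
    using assms by (intro sum.mono_neutral_cong_right) (auto simp: moebius_mu_def intro: finite_divisors_nat)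
  also have "\<dots> = (\<Sum>X\<in>Pow (prime_factors n). (-1) ^ card X)"
  proof (rule sum.reindex_bij_witness[where i = "\<lambda>X. \<Prod>X" and j = prime_factors])
    fix d assume d: "d \<in> {d. d dvd n \<and> squarefree d}"
    show "\<Prod>(prime_factors d) = d" using d by (intro prod_prime_factors_squarefree) auto
    show "prime_factors d \<in> Pow (prime_factors n)" using d assms by (auto intro: dvd_prime_factors[THEN subsetD])
  next
    fix X assume X: "X \<in> Pow (prime_factors n)"
    hence fin: "finite X" and pr: "\<And>p. p \<in> X \<Longrightarrow> prime p" by (auto intro: finite_subset)
    have "\<Prod>X dvd \<Prod>(prime_factors n)" using X by (intro prod_dvd_prod_subset) auto
    hence "\<Prod>X dvd n" using prod_prime_factors_dvd[OF assms] dvd_trans by blast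
    moreover have "squarefree (\<Prod>x\<in>X. x)"
      using pr by (intro squarefree_prod_coprime) (auto intro: primes_coprime squarefree_prime)
    ultimately show "\<Prod>X \<in> {d. d dvd n \<and> squarefree d}" by simp
    show "prime_factors (\<Prod>X) = X"
    proof -
      have "0 \<notin> (\<lambda>x. x) ` X" using pr not_prime_0 by (metis image_ident)
      thus ?thesis using fin pr by (subst prime_factors_prod) (auto simp: prime_prime_factors)
    qed
  qed auto
  also have "\<dots> = (\<Prod>x\<in>prime_factors n. (1 - 1 :: real))"
    by (subst prod_diff_conv_sum) auto
  also have "\<dots> = (if n = 1 then 1 else 0)"
    using assms by (auto simp: prime_factorization_empty_iff card_gt_0_iff)
  finally show ?thesis .
qed

section \<open>Partial summation and the value of the L-series\<close>

text \<open>Summation by parts: the differences of the decreasing sequence are nonnegative and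
  telescope, so every partial sum of c may be replaced by its bound B.\<close>

lemma abel_bound:
  fixes c :: "nat \<Rightarrow> 'a::real_normed_vector" and b :: "nat \<Rightarrow> real"
  assumes S: "\<And>K. norm (\<Sum>n\<in>{M..<K}. c n) \<le> B"
    and dec: "\<And>n. n \<ge> M \<Longrightarrow> b (Suc n) \<le> b n" and nonneg: "\<And>n. n \<ge> M \<Longrightarrow> 0 \<le> b n"
  shows "norm (\<Sum>n\<in>{M..<K}. b n *\<^sub>R c n) \<le> B * b M"
proof (cases "M \<le> K")
  case True
  let ?S = "\<lambda>K. \<Sum>n\<in>{M..<K}. c n"
  have eq: "(\<Sum>n\<in>{M..<K}. b n *\<^sub>R c n) = b K *\<^sub>R ?S K + (\<Sum>n\<in>{M..<K}. (b n - b (Suc n)) *\<^sub>R ?S (Suc n))"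
    using True
    by (induction K rule: dec_induct)
       (auto simp: sum.atLeastLessThan_Suc algebra_simps)
  have "norm (\<Sum>n\<in>{M..<K}. b n *\<^sub>R c n)
      \<le> norm (b K *\<^sub>R ?S K) + norm (\<Sum>n\<in>{M..<K}. (b n - b (Suc n)) *\<^sub>R ?S (Suc n))"
    unfolding eq by (rule norm_triangle_ineq)
  also have "\<dots> \<le> b K * B + (\<Sum>n\<in>{M..<K}. (b n - b (Suc n)) * B)"
    using nonneg[OF True] S dec
    by (intro add_mono sum_norm_le) (auto intro!: mult_left_mono simp del: sum.op_ivl_Suc)
  also have "(\<Sum>n\<in>{M..<K}. (b n - b (Suc n)) * B) = (b M - b K) * B"
    unfolding sum_distrib_right[symmetric] using sum_Suc_diff'[OF True, of "\<lambda>n. - b n"] by simp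
  finally show ?thesis by (simp add: algebra_simps)
next
  case False
  have "0 \<le> B" using S[of 0] by simp
  thus ?thesis using False nonneg[of M] by simp
qed

lemma norm_sum_dchar_interval_le:
  assumes "dchar m \<eta>" "\<eta> \<noteq> principal_dchar m" "m > 0"
  shows "norm (\<Sum>n\<in>{M..<K}. \<eta> n) \<le> 2 * real m"
proof (cases "M \<le> K")
  case True
  hence "(\<Sum>n\<in>{M..<K}. \<eta> n) = (\<Sum>n<K. \<eta> n) - (\<Sum>n<M. \<eta> n)"
    by (simp add: sum_diff_nat_ivl[of 0 M K, symmetric] atLeast0LessThan)
  also have "norm \<dots> \<le> real m + real m"
    using norm_sum_dchar_le[OF assms] by (intro norm_triangle_le_diff add_mono)
  finally show ?thesis by simp
qed auto

lemma norm_sum_dchar_over_n_le: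
  assumes "dchar m \<eta>" "\<eta> \<noteq> principal_dchar m" "m > 0" "M > 0"
  shows "norm (\<Sum>n\<in>{M..<K}. \<eta> n / of_nat n) \<le> 2 * real m / real M"
proof -
  have "norm (\<Sum>n\<in>{M..<K}. (1 / real n) *\<^sub>R \<eta> n) \<le> 2 * real m * (1 / real M)"
    using assms(4) by (intro abel_bound norm_sum_dchar_interval_le[OF assms(1-3)]) (auto simp: field_simps)
  thus ?thesis by (simp add: scaleR_conv_of_real)
qed

lemma norm_dchar_partial_sums_diff_le:
  assumes "dchar m \<eta>" "\<eta> \<noteq> principal_dchar m" "m > 0" "K \<le> K'"
  shows "norm ((\<Sum>k=1..K'. \<eta> k / of_nat k) - (\<Sum>k=1..K. \<eta> k / of_nat k)) \<le> 2 * real m / real (Suc K)"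
proof -
  have "{1..K'} = {1..K} \<union> {Suc K..<Suc K'}" using assms(4) by auto
  hence "(\<Sum>k=1..K'. \<eta> k / of_nat k) = (\<Sum>k=1..K. \<eta> k / of_nat k) + (\<Sum>k\<in>{Suc K..<Suc K'}. \<eta> k / of_nat k)"
    by (simp only:) (rule sum.union_disjoint, auto)
  thus ?thesis using norm_sum_dchar_over_n_le[OF assms(1-3), of "Suc K" "Suc K'"] by simp
qed

text \<open>The value L(1, \<eta>). For the principal character the partial sums diverge and the
  value is arbitrary; the results below concern nonprincipal characters.\<close>

definition dchar_L :: "(nat \<Rightarrow> complex) \<Rightarrow> complex" where
  "dchar_L \<eta> = lim (\<lambda>K. \<Sum>k=1..K. \<eta> k / of_nat k)"

lemma dchar_L_LIMSEQ:
  assumes "dchar m \<eta>" "\<eta> \<noteq> principal_dchar m" "m > 0"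
  shows "(\<lambda>K. \<Sum>k=1..K. \<eta> k / of_nat k) \<longlonglongrightarrow> dchar_L \<eta>"
proof -
  note diff = norm_dchar_partial_sums_diff_le[OF assms]
  have "Cauchy (\<lambda>K. \<Sum>k=1..K. \<eta> k / of_nat k)"
  proof (rule metric_CauchyI)
    fix e :: real assume e: "e > 0"
    obtain M where M: "real M > 2 * real m / e" using reals_Archimedean2 by blast
    have small: "2 * real m / real (Suc K) < e" if "K \<ge> M" for K
    proof -
      have "2 * real m < e * real M" using M e by (simp add: field_simps)
      also have "\<dots> \<le> e * real (Suc K)" using that e by (intro mult_left_mono) auto
      finally show ?thesis by (simp add: field_simps)
    qed
    show "\<exists>M. \<forall>i\<ge>M. \<forall>j\<ge>M. dist (\<Sum>k=1..i. \<eta> k / of_nat k) (\<Sum>k=1..j. \<eta> k / of_nat k) < e"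
    proof (intro exI[of _ M] allI impI)
      fix i j assume "i \<ge> M" "j \<ge> M"
      thus "dist (\<Sum>k=1..i. \<eta> k / of_nat k) (\<Sum>k=1..j. \<eta> k / of_nat k) < e"
        using diff[of i j] diff[of j i] small[of i] small[of j]
        by (cases "i \<le> j") (auto simp: dist_norm norm_minus_commute)
    qed
  qed
  thus ?thesis unfolding dchar_L_def by (simp add: Cauchy_convergent_iff convergent_LIMSEQ_iff)
qed

text \<open>The rate matters as much as the limit: with K = \<open>N div d\<close>, the inequality d
  (K + 1) > N makes 1/d times this error at most 2 m / N, uniformly in d.\<close>

lemma dchar_L_error:
  assumes "dchar m \<eta>" "\<eta> \<noteq> principal_dchar m" "m > 0"
  shows "norm ((\<Sum>k=1..K. \<eta> k / of_nat k) - dchar_L \<eta>) \<le> 2 * real m / real (Suc K)"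
proof -
  have "norm (dchar_L \<eta> - (\<Sum>k=1..K. \<eta> k / of_nat k)) \<le> 2 * real m / real (Suc K)"
  proof (rule LIMSEQ_le_const2)
    show "(\<lambda>K'. norm ((\<Sum>k=1..K'. \<eta> k / of_nat k) - (\<Sum>k=1..K. \<eta> k / of_nat k)))
           \<longlonglongrightarrow> norm (dchar_L \<eta> - (\<Sum>k=1..K. \<eta> k / of_nat k))"
      by (intro tendsto_intros dchar_L_LIMSEQ[OF assms])
    thus "\<exists>M. \<forall>n\<ge>M. norm ((\<Sum>k=1..n. \<eta> k / of_nat k) - (\<Sum>k=1..K. \<eta> k / of_nat k)) \<le> 2 * real m / real (Suc K)"
      using norm_dchar_partial_sums_diff_le[OF assms] by blast
  qed
  thus ?thesis by (simp add: norm_minus_commute)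
qed

text \<open>(ln x) / x decreases from x = e on, hence the bound 3.\<close>

lemma ln_over_n_decreasing:
  assumes "n \<ge> 3"
  shows "ln (real (Suc n)) / real (Suc n) \<le> ln (real n) / real n"
proof -
  have n: "real n > 0" using assms by simp
  have "ln (1 + 1 / real n) \<le> 1 / real n" using n by (intro ln_add_one_self_le_self) auto
  moreover have "ln (1 + 1 / real n) = ln (real (Suc n)) - ln (real n)"
  proof -
    have "1 + 1 / real n = real (Suc n) / real n" using n by (simp add: field_simps)
    thus ?thesis using n ln_div[of "real (Suc n)" "real n"] by auto
  qed
  moreover have "1 \<le> ln (real n)"
  proof -
    have "exp 1 \<le> real n" using exp_le assms by linarith
    thus ?thesis using n by (simp add: ln_ge_iff)
  qed
  ultimately have le: "ln (real (Suc n)) - ln (real n) \<le> 1 / real n" and "1 \<le> ln (real n)"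
    by simp_all
  have "real n * (ln (real (Suc n)) - ln (real n)) \<le> real n * (1 / real n)"
    using le n by (intro mult_left_mono) auto
  hence "real n * (ln (real (Suc n)) - ln (real n)) \<le> ln (real n)"
    using n \<open>1 \<le> ln (real n)\<close> by simp
  thus ?thesis using n by (simp add: field_simps)
qed

text \<open>These are the partial sums of -L'(1, \<eta>). The weights decrease only from n = 3 on,
  so the terms with n < 3 are bounded separately.\<close>

lemma sum_dchar_ln_over_n_bounded:
  assumes "dchar m \<eta>" "\<eta> \<noteq> principal_dchar m" "m > 0"
  obtains B where "\<And>K. norm (\<Sum>n=1..K. \<eta> n * ln (real n) / of_nat n) \<le> B"
proof
  fix K
  let ?b = "\<lambda>n::nat. ln (real n) / real n"
  let ?f = "\<lambda>n. ?b n *\<^sub>R \<eta> n"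
  have "norm (\<Sum>n\<in>{3..<Suc K}. ?f n) \<le> 2 * real m * ?b 3"
    by (intro abel_bound norm_sum_dchar_interval_le[OF assms] ln_over_n_decreasing) auto
  moreover have "norm (\<Sum>n\<in>{1..<min 3 (Suc K)}. ?f n) \<le> (\<Sum>n\<in>{1..<3}. norm (?f n))"
    by (rule order_trans[OF norm_sum]) (rule sum_mono2, auto)
  moreover have "(\<Sum>n=1..K. ?f n) = (\<Sum>n\<in>{1..<min 3 (Suc K)}. ?f n) + (\<Sum>n\<in>{3..<Suc K}. ?f n)"
    by (subst sum.union_disjoint[symmetric]) (auto intro!: sum.cong)
  ultimately have "norm (\<Sum>n=1..K. ?f n) \<le> (\<Sum>n\<in>{1..<3}. norm (?f n)) + 2 * real m * ?b 3"
    using norm_triangle_ineq[of "(\<Sum>n\<in>{1..<min 3 (Suc K)}. ?f n)" "(\<Sum>n\<in>{3..<Suc K}. ?f n)"]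
    by (simp only:)
  thus "norm (\<Sum>n=1..K. \<eta> n * ln (real n) / of_nat n) \<le> (\<Sum>n\<in>{1..<3}. norm (?f n)) + 2 * real m * ?b 3"
    by (simp add: scaleR_conv_of_real mult.commute)
qed

section \<open>Mertens' sum twisted by a character\<close>

text \<open>Partial sums of -L'/L at 1. Their growth against ln N reveals whether L(1, \<eta>)
  vanishes.\<close>

definition dchar_A :: "(nat \<Rightarrow> complex) \<Rightarrow> nat \<Rightarrow> complex" where
  "dchar_A \<eta> N = (\<Sum>n=1..N. \<eta> n * mangoldt n / of_nat n)"

text \<open>Expanding ln n over divisors, the bounded sum of \<eta> n (ln n) / n becomes the terms
  of \<open>dchar_A\<close>, each multiplied by the partial sum of the L-series up to
  \<open>N div d\<close>. Replacing those partial sums by L(1, \<eta>) costs 8 m, from the error 2 m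
  / N for each d and Chebyshev's 4 N.\<close>

lemma dchar_A_L_bounded:
  assumes "dchar m \<eta>" "\<eta> \<noteq> principal_dchar m" "m > 0"
  obtains B where "\<And>N. N > 0 \<Longrightarrow> norm (dchar_L \<eta> * dchar_A \<eta> N) \<le> B"
proof -
  obtain B where B: "\<And>K. norm (\<Sum>n=1..K. \<eta> n * ln (real n) / of_nat n) \<le> B"
    using sum_dchar_ln_over_n_bounded[OF assms] by blast
  have "norm (dchar_L \<eta> * dchar_A \<eta> N) \<le> B + 8 * real m" if N: "N > 0" for N
  proof -
    let ?S = "\<lambda>K. \<Sum>k=1..K. \<eta> k / of_nat k"
    have "(\<Sum>n=1..N. \<eta> n * ln (real n) / of_nat n)
        = (\<Sum>n=1..N. \<Sum>d | d dvd n. (\<eta> d * mangoldt d / of_nat d) * (\<eta> (n div d) / of_nat (n div d)))"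
    proof (rule sum.cong)
      fix n assume n: "n \<in> {1..N}"
      have "\<eta> n * ln (real n) / of_nat n = (\<Sum>d | d dvd n. \<eta> n * mangoldt d / of_nat n)"
        using n by (simp add: mangoldt_sum sum_distrib_left[symmetric] sum_divide_distrib[symmetric])
      also have "\<dots> = (\<Sum>d | d dvd n. (\<eta> d * mangoldt d / of_nat d) * (\<eta> (n div d) / of_nat (n div d)))"
      proof (rule sum.cong)
        fix d assume "d \<in> {d. d dvd n}"
        then obtain k where k: "n = d * k" by auto
        thus "\<eta> n * mangoldt d / of_nat n = (\<eta> d * mangoldt d / of_nat d) * (\<eta> (n div d) / of_nat (n div d))"
          using n by (auto simp: dchar_mult[OF assms(1)])
      qed auto
      finally show "\<eta> n * ln (real n) / of_nat n =
        (\<Sum>d | d dvd n. (\<eta> d * mangoldt d / of_nat d) * (\<eta> (n div d) / of_nat (n div d)))" .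
    qed auto
    also have "\<dots> = (\<Sum>d=1..N. \<Sum>k=1..N div d. (\<eta> d * mangoldt d / of_nat d) * (\<eta> k / of_nat k))"
      by (rule sum_divisors_swap)
    also have "\<dots> = (\<Sum>d=1..N. (\<eta> d * mangoldt d / of_nat d) * ?S (N div d))"
      by (simp only: sum_distrib_left)
    finally have eq: "(\<Sum>n=1..N. \<eta> n * ln (real n) / of_nat n) =
        (\<Sum>d=1..N. (\<eta> d * mangoldt d / of_nat d) * ?S (N div d))" .
    have "norm ((\<Sum>n=1..N. \<eta> n * ln (real n) / of_nat n) - dchar_L \<eta> * dchar_A \<eta> N)
        = norm (\<Sum>d=1..N. (\<eta> d * mangoldt d / of_nat d) * (?S (N div d) - dchar_L \<eta>))"
    proof -
      have "dchar_L \<eta> * dchar_A \<eta> N = (\<Sum>d=1..N. dchar_L \<eta> * (\<eta> d * mangoldt d / of_nat d))"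
        unfolding dchar_A_def by (rule sum_distrib_left)
      thus ?thesis unfolding eq
        by (simp only: sum_subtractf[symmetric] right_diff_distrib mult.commute)
    qed
    also have "\<dots> \<le> (\<Sum>d=1..N. mangoldt d * (2 * real m / real N))"
    proof (rule sum_norm_le)
      fix d assume d: "d \<in> {1..N}"
      have "N < d * Suc (N div d)"
        using d dividend_less_times_div[of d N] by auto
      hence lt: "real N \<le> real d * real (Suc (N div d))"
        unfolding of_nat_mult[symmetric] of_nat_le_iff by simp
      have "norm ((\<eta> d * mangoldt d / of_nat d) * (?S (N div d) - dchar_L \<eta>))
          = norm (\<eta> d) * (mangoldt d / real d) * norm (?S (N div d) - dchar_L \<eta>)"
        by (simp add: norm_mult norm_divide)
      also have "\<dots> \<le> 1 * (mangoldt d / real d) * (2 * real m / real (Suc (N div d)))"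
        by (intro mult_mono norm_dchar_le_1[OF assms(1,3)] dchar_L_error[OF assms])
           (auto simp: mangoldt_nonneg)
      also have "\<dots> = mangoldt d * (2 * real m) / (real d * real (Suc (N div d)))" by simp
      also have "\<dots> \<le> mangoldt d * (2 * real m) / real N"
        using lt N by (intro divide_left_mono) (auto simp: mangoldt_nonneg)
      finally show "norm ((\<eta> d * mangoldt d / of_nat d) * (?S (N div d) - dchar_L \<eta>)) \<le> mangoldt d * (2 * real m / real N)" by simp
    qed
    also have "\<dots> \<le> (4 * real N) * (2 * real m / real N)"
      unfolding sum_distrib_right[symmetric] by (intro mult_right_mono chebyshev_psi_le) auto
    also have "\<dots> = 8 * real m" using N by simp
    finally have "norm ((\<Sum>n=1..N. \<eta> n * ln (real n) / of_nat n) - dchar_L \<eta> * dchar_A \<eta> N) \<le> 8 * real m" .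
    thus ?thesis using B[of N] norm_triangle_ineq2[of "dchar_L \<eta> * dchar_A \<eta> N" "\<Sum>n=1..N. \<eta> n * ln (real n) / of_nat n"]
      by (simp add: norm_minus_commute)
  qed
  thus ?thesis using that by blast
qed


text \<open>With ln (N/d) = ln (N/n) + ln (n/d), the first part survives only at n = 1, and the
  second is Moebius inversion of the divisor sum of \<open>mangoldt\<close>.\<close>

lemma ln_over_div_moebius_sum:
  assumes "n \<in> {1..N}"
  shows "(\<Sum>d | d dvd n. moebius_mu d * ln (real N / real d)) = (if n = 1 then ln (real N) else 0) + mangoldt n"
proof -
  let ?D = "{d. d dvd n}"
  have n: "n > 0" "finite ?D" using assms by (auto intro: finite_divisors_nat)
  have "(\<Sum>d\<in>?D. moebius_mu d * ln (real N / real d))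
      = (\<Sum>d\<in>?D. moebius_mu d * ln (real N / real n) + moebius_mu d * ln (real (n div d)))"
  proof (rule sum.cong)
    fix d assume "d \<in> ?D"
    then obtain k where k: "n = d * k" by auto
    hence "d > 0" "k > 0" using n by auto
    hence "ln (real N / real d) = ln (real N / real n) + ln (real (n div d))"
      using assms k n by (auto simp: ln_div ln_mult)
    thus "moebius_mu d * ln (real N / real d) = moebius_mu d * ln (real N / real n) + moebius_mu d * ln (real (n div d))"
      by (simp add: algebra_simps)
  qed auto
  also have "\<dots> = (\<Sum>d\<in>?D. moebius_mu d) * ln (real N / real n) + (\<Sum>d\<in>?D. moebius_mu d * ln (real (n div d)))"
    by (simp add: sum.distrib sum_distrib_right)
  also have "(\<Sum>d\<in>?D. moebius_mu d) * ln (real N / real n) = (if n = 1 then ln (real N) else 0)"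
    using n by (simp add: sum_moebius_divisors)
  also have "(\<Sum>d\<in>?D. moebius_mu d * ln (real (n div d))) = (\<Sum>d\<in>?D. \<Sum>e | e \<in> ?D \<and> d * e dvd n. moebius_mu d * mangoldt e)"
  proof (rule sum.cong)
    fix d assume d: "d \<in> ?D"
    hence "{e. e \<in> ?D \<and> d * e dvd n} = {e. e dvd n div d}"
      using n by (auto simp: dvd_div_iff_mult mult.commute dest: dvd_mult_right dvd_mult_left)
    moreover have "n div d \<noteq> 0" using d n by (auto simp: dvd_div_eq_0_iff)
    ultimately show "moebius_mu d * ln (real (n div d)) = (\<Sum>e | e \<in> ?D \<and> d * e dvd n. moebius_mu d * mangoldt e)"
      using mangoldt_sum[of "n div d", where ?'a = real] by (simp add: sum_distrib_left[symmetric])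
  qed auto
  also have "\<dots> = (\<Sum>e\<in>?D. \<Sum>d | d \<in> ?D \<and> d * e dvd n. moebius_mu d * mangoldt e)"
    using n by (intro sum.swap_restrict)
  also have "\<dots> = (\<Sum>e\<in>?D. if e = n then mangoldt e else 0)"
  proof (rule sum.cong)
    fix e assume e: "e \<in> ?D"
    hence "{d. d \<in> ?D \<and> d * e dvd n} = {d. d dvd n div e}"
      using n by (auto simp: dvd_div_iff_mult mult.commute dest: dvd_mult_right dvd_mult_left)
    hence "(\<Sum>d | d \<in> ?D \<and> d * e dvd n. moebius_mu d * mangoldt e) = (\<Sum>d | d dvd n div e. moebius_mu d) * mangoldt e"
      by (simp add: sum_distrib_right)
    also have "\<dots> = (if e = n then mangoldt e else 0)"
    proof -
      have "n div e > 0" using e n by (auto simp: dvd_div_eq_0_iff intro!: Nat.gr0I)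
      moreover have "n div e = 1 \<longleftrightarrow> e = n" using e n by auto
      ultimately show ?thesis by (simp add: sum_moebius_divisors)
    qed
    finally show "(\<Sum>d | d \<in> ?D \<and> d * e dvd n. moebius_mu d * mangoldt e) = (if e = n then mangoldt e else 0)" .
  qed auto
  also have "\<dots> = mangoldt n" using n by (simp add: sum.delta)
  finally show ?thesis .
qed

text \<open>The weights \<open>moebius_mu d * ln (real N / real d)\<close> bring in partial sums of
  the L-series up to \<open>N div d\<close>. If the limit is 0, these are at most 2 m / (N div d +
  1). Thus a zero forces \<open>dchar_A\<close> to stay close to -ln N, whereas a nonzero value
  keeps it bounded.\<close>

lemma dchar_A_zero_bounded:
  assumes "dchar m \<eta>" "\<eta> \<noteq> principal_dchar m" "m > 0" "dchar_L \<eta> = 0" "N > 0"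
  shows "norm (dchar_A \<eta> N + ln (real N)) \<le> 2 * real m"
proof -
  let ?S = "\<lambda>K. \<Sum>k=1..K. \<eta> k / of_nat k"
  let ?g = "\<lambda>d. of_real (moebius_mu d * ln (real N / real d)) * (\<eta> d / of_nat d)"
  have "dchar_A \<eta> N + ln (real N)
      = (\<Sum>n=1..N. of_real ((if n = 1 then ln (real N) else 0) + mangoldt n) * (\<eta> n / of_nat n))"
  proof -
    have "(\<Sum>n=1..N. of_real ((if n = 1 then ln (real N) else 0) + mangoldt n) * (\<eta> n / of_nat n))
        = (\<Sum>n=1..N. (if n = 1 then of_real (ln (real N)) else 0)) + dchar_A \<eta> N"
      unfolding dchar_A_def sum.distrib[symmetric]
      by (rule sum.cong) (auto simp: algebra_simps dchar_1[OF assms(1)])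
    thus ?thesis using assms(5) by (simp add: sum.delta)
  qed
  also have "\<dots> = (\<Sum>n=1..N. \<Sum>d | d dvd n. ?g d * (\<eta> (n div d) / of_nat (n div d)))"
  proof (rule sum.cong)
    fix n assume n: "n \<in> {1..N}"
    have "of_real ((if n = 1 then ln (real N) else 0) + mangoldt n) * (\<eta> n / of_nat n)
        = (\<Sum>d | d dvd n. of_real (moebius_mu d * ln (real N / real d)) * (\<eta> n / of_nat n))"
      unfolding ln_over_div_moebius_sum[OF n, symmetric] of_real_sum sum_distrib_right ..
    also have "\<dots> = (\<Sum>d | d dvd n. ?g d * (\<eta> (n div d) / of_nat (n div d)))"
    proof (rule sum.cong)
      fix d assume "d \<in> {d. d dvd n}"
      then obtain k where k: "n = d * k" by auto
      thus "of_real (moebius_mu d * ln (real N / real d)) * (\<eta> n / of_nat n) = ?g d * (\<eta> (n div d) / of_nat (n div d))"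
        using n by (auto simp: dchar_mult[OF assms(1)])
    qed auto
    finally show "of_real ((if n = 1 then ln (real N) else 0) + mangoldt n) * (\<eta> n / of_nat n)
        = (\<Sum>d | d dvd n. ?g d * (\<eta> (n div d) / of_nat (n div d)))" .
  qed auto
  also have "\<dots> = (\<Sum>d=1..N. \<Sum>k=1..N div d. ?g d * (\<eta> k / of_nat k))"
    by (rule sum_divisors_swap)
  also have "\<dots> = (\<Sum>d=1..N. ?g d * ?S (N div d))" by (simp only: sum_distrib_left)
  also have "norm \<dots> \<le> (\<Sum>d=1..N. ln (real N / real d) * (2 * real m / real N))"
  proof (rule sum_norm_le)
    fix d assume d: "d \<in> {1..N}"
    have "N < d * Suc (N div d)"
      using d dividend_less_times_div[of d N] by auto
    hence lt: "real N \<le> real d * real (Suc (N div d))"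
      unfolding of_nat_mult[symmetric] of_nat_le_iff by simp
    have ln0: "ln (real N / real d) \<ge> 0" using d by (auto intro!: ln_ge_zero)
    have "norm (?g d * ?S (N div d)) = \<bar>moebius_mu d\<bar> * ln (real N / real d) * (norm (\<eta> d) / real d) * norm (?S (N div d))"
      using ln0 by (simp add: norm_mult norm_divide abs_mult)
    also have "\<dots> \<le> 1 * ln (real N / real d) * (1 / real d) * (2 * real m / real (Suc (N div d)))"
      using ln0 dchar_L_error[OF assms(1-3), of "N div d"] assms(4)
      by (intro mult_mono divide_right_mono abs_moebius_le norm_dchar_le_1[OF assms(1,3)]) auto
    also have "\<dots> = ln (real N / real d) * (2 * real m) / (real d * real (Suc (N div d)))" by simp
    also have "\<dots> \<le> ln (real N / real d) * (2 * real m) / real N"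
      using lt assms(5) ln0 by (intro divide_left_mono) auto
    finally show "norm (?g d * ?S (N div d)) \<le> ln (real N / real d) * (2 * real m / real N)" by simp
  qed
  also have "\<dots> = (\<Sum>d=1..N. ln (real N) - ln (real d)) * (2 * real m / real N)"
    unfolding sum_distrib_right using assms(5) by (intro sum.cong) (auto simp: ln_div)
  also have "\<dots> \<le> real N * (2 * real m / real N)"
  proof (rule mult_right_mono)
    \<comment> \<open>By the Stirling lower bound, ln (N/d) is at most 1 on average over d.\<close>
    have "(\<Sum>d=1..N. ln (real N) - ln (real d)) = real N * ln (real N) - ln (fact N)"
      unfolding fact_prod of_nat_prod by (subst ln_prod) (auto simp: sum_subtractf)
    thus "(\<Sum>d=1..N. ln (real N) - ln (real d)) \<le> real N" using ln_fact_bounds(2)[of N] by linarith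
  qed auto
  also have "\<dots> = 2 * real m" using assms(5) by simp
  finally show ?thesis .
qed

section \<open>Nonvanishing of L(1, \<eta>) for real characters\<close>

lemma divisors_prime_power_mult:
  assumes p: "prime (p::nat)" "\<not> p dvd r" "r > 0"
  shows "bij_betw (\<lambda>(j,d). p ^ j * d) ({..k} \<times> {d. d dvd r}) {d. d dvd p ^ k * r}"
  unfolding bij_betw_def
proof
  have p1: "p > 1" using p(1) prime_gt_1_nat by blast
  have nd: "\<not> p dvd d" if "d dvd r" for d using that p(2) dvd_trans by blast
  show "inj_on (\<lambda>(j,d). p ^ j * d) ({..k} \<times> {d. d dvd r})"
  proof (rule inj_onI, clarify)
    fix j d j' d' assume *: "d dvd r" "d' dvd r" "p ^ j * d = p ^ j' * d'"
    have 1: "multiplicity p (p ^ j * d) = j" if "d dvd r" for j d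
      using nd[OF that] p1 by (intro multiplicity_eqI) (auto simp: mult.commute)
    have "j = j'" using 1[OF *(1), of j] 1[OF *(2), of j'] *(3) by simp
    thus "j = j' \<and> d = d'" using * p1 by auto
  qed
  show "(\<lambda>(j,d). p ^ j * d) ` ({..k} \<times> {d. d dvd r}) = {d. d dvd p ^ k * r}"
  proof (intro equalityI subsetI)
    fix x assume "x \<in> (\<lambda>(j,d). p ^ j * d) ` ({..k} \<times> {d. d dvd r})"
    thus "x \<in> {d. d dvd p ^ k * r}" by (auto intro!: mult_dvd_mono le_imp_power_dvd)
  next
    fix x assume "x \<in> {d. d dvd p ^ k * r}"
    then obtain b c where bc: "x = b * c" "b dvd p ^ k" "c dvd r" by (auto elim: division_decomp[THEN exE])
    then obtain j where "j \<le> k" "b = p ^ j" using divides_primepow_nat[OF p(1)] by blast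
    thus "x \<in> (\<lambda>(j,d). p ^ j * d) ` ({..k} \<times> {d. d dvd r})" using bc by force
  qed
qed

lemma sum_divisors_prime_power_mult:
  fixes h :: "nat \<Rightarrow> real"
  assumes h: "\<And>a b. h (a * b) = h a * h b" and p: "prime p" "\<not> p dvd r" "r > 0"
  shows "(\<Sum>d | d dvd p ^ k * r. h d) = (\<Sum>j\<le>k. h (p ^ j)) * (\<Sum>d | d dvd r. h d)"
proof -
  have "(\<Sum>d | d dvd p ^ k * r. h d) = (\<Sum>(j,d)\<in>{..k} \<times> {d. d dvd r}. h (p ^ j * d))"
    by (subst sum.reindex_bij_betw[OF divisors_prime_power_mult[OF p], symmetric]) (simp add: case_prod_unfold)
  also have "\<dots> = (\<Sum>j\<le>k. \<Sum>d | d dvd r. h (p ^ j) * h d)"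
    by (simp add: sum.cartesian_product h)
  finally show ?thesis by (simp add: sum_product)
qed

lemma sum_powers_real_unit:
  assumes "z \<in> {-1, 0, 1::real}"
  shows "(\<Sum>j\<le>k. z ^ j) \<ge> 0" and "even k \<Longrightarrow> (\<Sum>j\<le>k. z ^ j) \<ge> 1"
proof -
  have "(\<Sum>j\<le>k. (-1::real) ^ j) = (if even k then 1 else 0)" by (induction k) auto
  moreover have "(\<Sum>j\<le>k. (0::real) ^ j) = 1" by (induction k) auto
  ultimately show "(\<Sum>j\<le>k. z ^ j) \<ge> 0" "even k \<Longrightarrow> (\<Sum>j\<le>k. z ^ j) \<ge> 1" using assms by auto
qed

text \<open>The divisor sum is multiplicative with factor 1 + z + ... + z^k at a prime power p^k,
  where z = h p is -1, 0 or 1. This factor is never negative, and at least 1 if k is even; in n^2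
  all exponents are even.\<close>

lemma sum_divisors_real_mult_nonneg:
  fixes h :: "nat \<Rightarrow> real"
  assumes h: "\<And>a b. h (a * b) = h a * h b" "h 1 = 1" "\<And>n. h n \<in> {-1, 0, 1}"
  shows "n > 0 \<Longrightarrow> (\<Sum>d | d dvd n. h d) \<ge> 0"
    and "n > 0 \<Longrightarrow> (\<Sum>d | d dvd n ^ 2. h d) \<ge> 1"
proof -
  have pw: "h (p ^ j) = h p ^ j" for p j by (induction j) (use h in auto)
  have "(\<Sum>d | d dvd n. h d) \<ge> 0 \<and> (\<Sum>d | d dvd n ^ 2. h d) \<ge> 1" if "n > 0" for n
    using that
  proof (induction n rule: less_induct)
    case (less n)
    show ?case
    proof (cases "n = 1")
      case False
      then obtain p where p: "prime p" "p dvd n" using prime_factor_nat by blast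
      define k where "k = multiplicity p n"
      obtain r where r: "n = p ^ k * r" "\<not> p dvd r"
        using multiplicity_decompose'[of n p] p less.prems unfolding k_def
        by (metis not_prime_unit not_gr_zero)
      have "k > 0" using r p by (cases "k = 0") auto
      have r0: "r > 0" using r less.prems by (auto intro!: Nat.gr0I)
      have "p ^ k > 1" using \<open>k > 0\<close> prime_gt_1_nat[OF p(1)] by (intro one_less_power) auto
      hence "r < n" using r r0 by auto
      note IH = less.IH[OF this r0]
      have 1: "(\<Sum>d | d dvd n. h d) = (\<Sum>j\<le>k. h p ^ j) * (\<Sum>d | d dvd r. h d)"
        unfolding r(1) pw[symmetric] by (rule sum_divisors_prime_power_mult) (use h p r r0 in auto)
      have "n ^ 2 = p ^ (2 * k) * r ^ 2" by (simp add: r(1) power_mult_distrib power_mult[symmetric] mult.commute)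
      moreover have "\<not> p dvd r ^ 2" using r(2) p(1) prime_dvd_power by blast
      ultimately have 2: "(\<Sum>d | d dvd n ^ 2. h d) = (\<Sum>j\<le>2*k. h p ^ j) * (\<Sum>d | d dvd r ^ 2. h d)"
        unfolding pw[symmetric] using sum_divisors_prime_power_mult[OF h(1) p(1), of "r^2" "2*k"] r0 by simp
      have "1 * 1 \<le> (\<Sum>j\<le>2*k. h p ^ j) * (\<Sum>d | d dvd r ^ 2. h d)"
        using IH sum_powers_real_unit(1)[OF h(3), of p "2*k"] sum_powers_real_unit(2)[OF h(3), of "2*k" p] by (intro mult_mono) auto
      thus ?thesis using 1 2 IH sum_powers_real_unit(1)[OF h(3), of p k] by simp
    qed (use h in auto)
  qed
  thus "n > 0 \<Longrightarrow> (\<Sum>d | d dvd n. h d) \<ge> 0" "n > 0 \<Longrightarrow> (\<Sum>d | d dvd n ^ 2. h d) \<ge> 1" by auto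
qed

text \<open>AM-GM for the terms of a geometric sum of ratio \<open>t = s\<^sup>2\<close>; the square root avoids half-integer exponents.\<close>

lemma geometric_sum_ge:
  assumes "0 \<le> (s::real)"
  shows "real n * s ^ (n - 1) \<le> (\<Sum>i<n. (s^2) ^ i)"
proof (induction n rule: nat_less_induct)
  case (1 n)
  show ?case
  proof (cases "n < 2")
    case True
    hence "n = 0 \<or> n = 1" by auto
    thus ?thesis by auto
  next
    case False
    then obtain k where k: "n = Suc (Suc k)" by (metis not_less_eq numeral_2_eq_2 less_Suc_eq_0_disj old.nat.exhaust)
    have IH: "real k * s ^ (k - 1) \<le> (\<Sum>i<k. (s^2) ^ i)" using 1 k by auto
    \<comment> \<open>The first and last terms are split off. By AM-GM they give at least 2 s^(n-1),
      and what remains is s^2 times the sum for n - 2.\<close>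
    have "(\<Sum>i<n. (s^2) ^ i) = 1 + s^2 * (\<Sum>i<k. (s^2) ^ i) + (s ^ Suc k)^2"
    proof -
      have "(\<Sum>i<Suc k. (s^2) ^ i) = 1 + (\<Sum>i<k. (s^2) ^ Suc i)" by (subst sum.lessThan_Suc_shift) simp
      moreover have "(s^2) ^ Suc k = (s ^ Suc k)^2" by (simp only: power_mult[symmetric] mult.commute)
      ultimately show ?thesis unfolding k sum.lessThan_Suc[of _ "Suc k"]
        by (simp only: sum_distrib_left power_Suc)
    qed
    moreover have "s^2 * (real k * s ^ (k - 1)) \<le> s^2 * (\<Sum>i<k. (s^2) ^ i)"
      using IH by (intro mult_left_mono) auto
    moreover have "s^2 * (real k * s ^ (k - 1)) = real k * s ^ Suc k"
      by (cases k) (auto simp: power2_eq_square)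
    moreover have "2 * s ^ Suc k \<le> 1 + (s ^ Suc k)^2"
      using sum_squares_bound[of 1 "s ^ Suc k"] by simp
    moreover have "real n * s ^ (n - 1) = real k * s ^ Suc k + 2 * s ^ Suc k"
      unfolding k by (simp add: algebra_simps)
    ultimately show ?thesis by linarith
  qed
qed

text \<open>Monsky's proof that the value at 1 is nonzero for real characters: with \<open>A n\<close> the sum of the
  character over the divisors of \<open>n\<close>, the series of \<open>A n * t ^ n\<close> is unbounded as \<open>t\<close> tends to 1,
  because \<open>A\<close> is nonnegative and at least 1 on squares; it equals the Lambert series of the character,
  which would be bounded by Abel summation against the decreasing sequence below.\<close>

definition lambert_gap :: "real \<Rightarrow> nat \<Rightarrow> real" where
  "lambert_gap t n = 1 / (real n * (1 - t)) - t ^ n / (1 - t ^ n)"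

text \<open>t^n is at most each of 1, t, ..., t^(n-1), whose sum is (1 - t^n) / (1 - t).\<close>

lemma lambert_gap_nonneg:
  assumes "0 < t" "t < 1" "n > 0"
  shows "0 \<le> lambert_gap t n"
proof -
  have tn: "t ^ n < 1" using assms by (simp add: power_less_one_iff)
  have "real n * t ^ n = (\<Sum>i<n. t ^ n)" by simp
  also have "\<dots> \<le> (\<Sum>i<n. t ^ i)" using assms by (intro sum_mono power_decreasing) auto
  finally have "(1 - t) * (real n * t ^ n) \<le> (1 - t) * (\<Sum>i<n. t ^ i)" using assms by (intro mult_left_mono) auto
  also have "\<dots> = 1 - t ^ n" by (rule one_diff_power_eq[symmetric])
  finally have "t ^ n * (real n * (1 - t)) \<le> 1 * (1 - t ^ n)" by (simp only: mult_ac mult_1)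
  hence "t ^ n / (1 - t ^ n) \<le> 1 / (real n * (1 - t))"
    using assms tn by (subst pos_divide_le_eq) (simp_all add: pos_le_divide_eq)
  thus ?thesis unfolding lambert_gap_def by simp
qed

text \<open>With G k = 1 + t + ... + t^(k-1) the claim reduces to n (n + 1) t^n <= G n * G (n + 1).
  For s^2 = t, \<open>geometric_sum_ge\<close> bounds the right side below by n (n + 1) s^(2 n - 1),
  and s < 1.\<close>

lemma lambert_gap_decreasing:
  assumes "0 < t" "t < 1" "n > 0"
  shows "lambert_gap t (Suc n) \<le> lambert_gap t n"
proof -
  define G where "G k = (\<Sum>i<k. t ^ i)" for k
  define s where "s = sqrt t"
  have s: "0 < s" "s < 1" "s^2 = t" using assms by (auto simp: s_def)
  have G: "1 - t ^ k = (1 - t) * G k" for k unfolding G_def by (rule one_diff_power_eq)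
  have Gpos: "G k > 0" if "k > 0" for k unfolding G_def using that assms by (intro sum_pos) auto
  have Gge: "real k * s ^ (k - 1) \<le> G k" for k
    using geometric_sum_ge[of s k] s unfolding G_def by auto
  have "real n * real (Suc n) * t ^ n \<le> real n * real (Suc n) * s ^ (2 * n - 1)"
    using s power_mult[of s 2 n] power_decreasing[of "2*n-1" "2*n" s] by (intro mult_left_mono) auto
  also have "\<dots> = (real n * s ^ (n - 1)) * (real (Suc n) * s ^ (Suc n - 1))"
  proof -
    have "s ^ (2*n - 1) = s ^ (n - 1) * s ^ (Suc n - 1)"
      unfolding power_add[symmetric] using assms(3) by (intro arg_cong[where f="power s"]) auto
    thus ?thesis by simp
  qed
  also have "\<dots> \<le> G n * G (Suc n)"
    using Gge[of n] Gge[of "Suc n"] s Gpos[OF assms(3)] by (intro mult_mono) auto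
  finally have key: "real n * real (Suc n) * t ^ n \<le> G n * G (Suc n)" .
  have "t ^ n / (1 - t ^ n) - t ^ Suc n / (1 - t ^ Suc n) = t ^ n * (1 - t) / ((1 - t ^ n) * (1 - t ^ Suc n))"
  proof -
    have "a / (1 - a) - a * t / (1 - a * t) = a * (1 - t) / ((1 - a) * (1 - a * t))"
      if "1 - a \<noteq> 0" "1 - a * t \<noteq> 0" for a
      by (subst diff_frac_eq[OF that]) (simp add: algebra_simps)
    moreover have "t ^ n < 1" "t ^ Suc n < 1"
      using assms by (simp_all only: power_less_one_iff) (use assms in auto)
    ultimately show ?thesis unfolding power_Suc2 by simp
  qed
  also have "\<dots> = (1 / (1 - t)) * (t ^ n / (G n * G (Suc n)))"
  proof -
    have "c * x / ((x * a) * (x * b)) = (1 / x) * (c / (a * b))" if "x \<noteq> 0" for a b c x :: real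
      using that by simp
    thus ?thesis unfolding G using assms(2) by simp
  qed
  also have "\<dots> \<le> (1 / (1 - t)) * (1 / (real n * real (Suc n)))"
  proof (rule mult_left_mono)
    show "t ^ n / (G n * G (Suc n)) \<le> 1 / (real n * real (Suc n))"
      using key Gpos[of n] Gpos[of "Suc n"] assms by (simp add: divide_simps mult.commute)
  qed (use assms in auto)
  also have "\<dots> = 1 / (real n * (1 - t)) - 1 / (real (Suc n) * (1 - t))"
    using assms by (simp add: divide_simps)
  finally show ?thesis unfolding lambert_gap_def by linarith
qed

lemma dchar_L_real_nonzero:
  assumes "dchar m \<eta>" "\<eta> \<noteq> principal_dchar m" "m > 0" "\<And>n. \<eta> n \<in> \<real>"
  shows "dchar_L \<eta> \<noteq> 0"
proof
  assume L0: "dchar_L \<eta> = 0"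
  define h where "h n = Re (\<eta> n)" for n
  have h\<eta>: "\<eta> n = of_real (h n)" for n using assms(4)[of n] by (simp add: h_def)
  have h_mult: "h (a * b) = h a * h b" for a b
  proof -
    have "complex_of_real (h (a * b)) = of_real (h a * h b)"
      using dchar_mult[OF assms(1), of a b] unfolding h\<eta> by simp
    thus ?thesis by (simp only: of_real_eq_iff)
  qed
  have h_1: "h 1 = 1" using dchar_1[OF assms(1)] by (simp add: h_def)
  have h_unit: "h n \<in> {-1, 0, 1}" for n
  proof -
    have "\<bar>h n\<bar> = (if coprime n m then 1 else 0)"
      using norm_dchar[OF assms(1,3), of n] unfolding h\<eta> by simp
    thus ?thesis by (auto split: if_splits)
  qed
  define A where "A n = (\<Sum>d | d dvd n. h d)" for n
  have hsum: "(\<lambda>K. \<Sum>k=1..K. h k / real k) \<longlonglongrightarrow> 0"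
  proof -
    have "(\<lambda>K. Re (\<Sum>k=1..K. \<eta> k / of_nat k)) \<longlonglongrightarrow> Re 0"
      using dchar_L_LIMSEQ[OF assms(1-3)] unfolding L0 by (rule tendsto_Re)
    thus ?thesis by (simp add: h_def)
  qed
  \<comment> \<open>A finite form of the Lambert identity. For each d, cutting the geometric series
    at \<open>N div d\<close> costs at most t^N / (1 - t), as d (N div d + 1) > N. Then t^d / (1 -
    t^d) is written as 1 / (d (1 - t)) minus \<open>lambert_gap t d\<close>; the gap part is at most
    2 m, since \<open>lambert_gap t 1\<close> is 1.\<close>
  have main: "(\<Sum>n=1..N. A n * t ^ n) \<le> (1 / (1 - t)) * (\<Sum>k=1..N. h k / real k) + 2 * real m + (1 / (1 - t)) * (real N * t ^ N)"
    if t: "0 < t" "t < 1" for t N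
  proof -
    have tn: "t ^ n < 1" if "n > 0" for n using t that by (simp add: power_less_one_iff)
    have "(\<Sum>n=1..N. A n * t ^ n) = (\<Sum>n=1..N. \<Sum>d | d dvd n. h d * (t ^ d) ^ (n div d))"
      unfolding A_def sum_distrib_right by (intro sum.cong) (auto simp: power_mult[symmetric])
    also have "\<dots> = (\<Sum>d=1..N. \<Sum>k=1..N div d. h d * (t ^ d) ^ k)" by (rule sum_divisors_swap)
    also have "\<dots> \<le> (\<Sum>d=1..N. h d * (t ^ d / (1 - t ^ d)) + t ^ N / (1 - t))"
    proof (rule sum_mono)
      fix d assume d: "d \<in> {1..N}"
      let ?K = "N div d"
      have "N < d * Suc ?K" using d dividend_less_times_div[of d N] by auto
      have K: "?K \<ge> 1" using d by (simp add: Suc_le_eq div_greater_zero_iff)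
      have "(\<Sum>k=1..?K. (t ^ d) ^ k) = ((t ^ d) ^ 1 - (t ^ d) ^ Suc ?K) / (1 - t ^ d)"
        using K tn[of d] d by (subst sum_gp) auto
      hence "(\<Sum>k=1..?K. h d * (t ^ d) ^ k) = h d * (t ^ d / (1 - t ^ d)) + (- h d) * (t ^ (d * Suc ?K) / (1 - t ^ d))"
      proof -
        have "(t ^ d) ^ Suc ?K = t ^ (d * Suc ?K)" by (rule power_mult[symmetric])
        moreover assume "(\<Sum>k=1..?K. (t ^ d) ^ k) = ((t ^ d) ^ 1 - (t ^ d) ^ Suc ?K) / (1 - t ^ d)"
        ultimately show ?thesis
          unfolding sum_distrib_left[symmetric] by (simp only: diff_divide_distrib right_diff_distrib power_one_right)
      qed
      also have "(- h d) * (t ^ (d * Suc ?K) / (1 - t ^ d)) \<le> 1 * (t ^ N / (1 - t))"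
      proof (rule mult_mono)
        show "- h d \<le> 1" using h_unit[of d] by auto
        show "t ^ (d * Suc ?K) / (1 - t ^ d) \<le> t ^ N / (1 - t)"
        proof (rule frac_le)
          show "t ^ (d * Suc ?K) \<le> t ^ N" using \<open>N < d * Suc ?K\<close> t by (intro power_decreasing) auto
          have "t ^ d \<le> t ^ 1" using d t by (intro power_decreasing) auto
          thus "1 - t \<le> 1 - t ^ d" by simp
        qed (use t in auto)
      qed (use t tn[of d] d in auto)
      finally show "(\<Sum>k=1..?K. h d * (t ^ d) ^ k) \<le> h d * (t ^ d / (1 - t ^ d)) + t ^ N / (1 - t)" by simp
    qed
    also have "\<dots> = (\<Sum>d=1..N. h d * (t ^ d / (1 - t ^ d))) + (1 / (1 - t)) * (real N * t ^ N)"
      by (simp add: sum.distrib)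
    also have "(\<Sum>d=1..N. h d * (t ^ d / (1 - t ^ d))) =
        (1 / (1 - t)) * (\<Sum>k=1..N. h k / real k) - (\<Sum>d=1..N. lambert_gap t d * h d)"
      unfolding sum_distrib_left sum_subtractf[symmetric] lambert_gap_def
      by (intro sum.cong) (auto simp: left_diff_distrib right_diff_distrib mult.commute)
    also have "- (\<Sum>d=1..N. lambert_gap t d * h d) \<le> 2 * real m"
    proof -
      have "norm (\<Sum>n\<in>{1..<Suc N}. lambert_gap t n *\<^sub>R \<eta> n) \<le> 2 * real m * lambert_gap t 1"
        by (intro abel_bound norm_sum_dchar_interval_le[OF assms(1-3)] lambert_gap_nonneg lambert_gap_decreasing t) auto
      also have "lambert_gap t 1 = 1" using t by (simp add: lambert_gap_def field_simps)
      also have "(\<Sum>n\<in>{1..<Suc N}. lambert_gap t n *\<^sub>R \<eta> n) = of_real (\<Sum>d=1..N. lambert_gap t d * h d)"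
        unfolding h\<eta> by (simp add: scaleR_conv_of_real atLeastLessThanSuc_atLeastAtMost)
      finally show ?thesis by (simp only: norm_of_real)
    qed
    ultimately show ?thesis by simp
  qed
  have squares: "(\<Sum>k=1..K. t ^ (k\<^sup>2)) \<le> (\<Sum>n=1..N. A n * t ^ n)" if t: "0 < t" "t < 1" and N: "K\<^sup>2 \<le> N" for t K N
  proof -
    have "(\<Sum>k=1..K. t ^ (k\<^sup>2)) \<le> (\<Sum>k=1..K. A (k\<^sup>2) * t ^ (k\<^sup>2))"
      using sum_divisors_real_mult_nonneg(2)[OF h_mult h_1 h_unit] t unfolding A_def
      by (intro sum_mono) (auto simp: mult_le_cancel_right1)
    also have "\<dots> = (\<Sum>n\<in>(\<lambda>k. k\<^sup>2) ` {1..K}. A n * t ^ n)"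
      by (subst sum.reindex) (auto simp: inj_on_def)
    also have "\<dots> \<le> (\<Sum>n=1..N. A n * t ^ n)"
    proof (rule sum_mono2)
      have "k\<^sup>2 \<le> N" if "k \<le> K" for k
        using that N power_mono[of k K 2] by linarith
      thus "(\<lambda>k. k\<^sup>2) ` {1..K} \<subseteq> {1..N}" by (auto simp: Suc_le_eq)
      show "0 \<le> A b * t ^ b" if "b \<in> {1..N} - (\<lambda>k. k\<^sup>2) ` {1..K}" for b
        using that t sum_divisors_real_mult_nonneg(1)[OF h_mult h_1 h_unit, of b] unfolding A_def by auto
    qed auto
    finally show ?thesis .
  qed
  \<comment> \<open>Here t is fixed and N grows: the first term vanishes because L(1, \<eta>) was
    assumed to be 0, the last because N t^N tends to 0.\<close>
  have bound: "(\<Sum>k=1..K. t ^ (k\<^sup>2)) \<le> 2 * real m" if t: "0 < t" "t < 1" for t K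
  proof (rule LIMSEQ_le_const)
    have "(\<lambda>N. real N * t ^ N) \<longlonglongrightarrow> 0" using t by (intro powser_times_n_limit_0) auto
    hence "(\<lambda>N. (1 / (1 - t)) * (\<Sum>k=1..N. h k / real k) + 2 * real m + (1 / (1 - t)) * (real N * t ^ N))
      \<longlonglongrightarrow> (1 / (1 - t)) * 0 + 2 * real m + (1 / (1 - t)) * 0"
      by (intro tendsto_intros hsum)
    thus "(\<lambda>N. (1 / (1 - t)) * (\<Sum>k=1..N. h k / real k) + 2 * real m + (1 / (1 - t)) * (real N * t ^ N))
      \<longlonglongrightarrow> 2 * real m" by simp
    show "\<exists>M. \<forall>N\<ge>M. (\<Sum>k=1..K. t ^ (k\<^sup>2)) \<le>
        (1 / (1 - t)) * (\<Sum>k=1..N. h k / real k) + 2 * real m + (1 / (1 - t)) * (real N * t ^ N)"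
      using squares[OF t, of K] main[OF t] by (meson order_trans)
  qed
  have "(\<Sum>k=1..K. (1::real) ^ (k\<^sup>2)) \<le> 2 * real m" for K
  proof (rule tendsto_upperbound)
    show "((\<lambda>t. \<Sum>k=1..K. t ^ (k\<^sup>2)) \<longlongrightarrow> (\<Sum>k=1..K. (1::real) ^ (k\<^sup>2))) (at_left 1)"
      by (intro tendsto_intros)
    show "\<forall>\<^sub>F t in at_left (1::real). (\<Sum>k=1..K. t ^ (k\<^sup>2)) \<le> 2 * real m"
      by (rule eventually_mono[OF eventually_at_left_real[of 0 1]]) (use bound in auto)
  qed auto
  \<comment> \<open>At t = 1 the sum over squares is K, so any K > 2 m is a contradiction.\<close>
  from this[of "2 * m + 1"] show False by simp
qed

section \<open>Mertens' theorem in residue classes\<close>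

lemma dchar_A_principal_bounded:
  assumes "m > 0" "N > 0"
  shows "norm (dchar_A (principal_dchar m) N - ln (real N)) \<le> 4 + (\<Sum>q\<in>prime_factors m. ln (real q) / (real q - 1))"
proof -
  have "dchar_A (principal_dchar m) N = of_real (\<Sum>n=1..N. if coprime n m then mangoldt n / real n else 0)"
    unfolding dchar_A_def principal_dchar_def of_real_sum by (intro sum.cong) auto
  also have "(\<Sum>n=1..N. if coprime n m then mangoldt n / real n else 0)
      = (\<Sum>n=1..N. mangoldt n / real n) - (\<Sum>n | n \<in> {1..N} \<and> \<not> coprime n m. mangoldt n / real n)"
  proof -
    have "(\<Sum>n | n \<in> {1..N} \<and> \<not> coprime n m. mangoldt n / real n :: real)
        = (\<Sum>n=1..N. if \<not> coprime n m then mangoldt n / real n else 0)"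
      by (simp add: sum.inter_filter[symmetric])
    moreover have "(\<Sum>n=1..N. if coprime n m then mangoldt n / real n else 0 :: real)
        = (\<Sum>n=1..N. mangoldt n / real n - (if \<not> coprime n m then mangoldt n / real n else 0))"
      by (rule sum.cong) auto
    ultimately show ?thesis by (simp only: sum_subtractf)
  qed
  finally have eq: "dchar_A (principal_dchar m) N - ln (real N) =
     of_real (((\<Sum>n=1..N. mangoldt n / real n) - ln (real N)) - (\<Sum>n | n \<in> {1..N} \<and> \<not> coprime n m. mangoldt n / real n))"
    by simp
  have "0 \<le> (\<Sum>n | n \<in> {1..N} \<and> \<not> coprime n m. mangoldt n / real n :: real)"
    by (intro sum_nonneg) (auto simp: mangoldt_nonneg)
  thus ?thesis
    unfolding eq norm_of_real using mertens_mangoldt[OF assms(2)] sum_mangoldt_noncoprime_le[OF assms(1), of N]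
    by linarith
qed

text \<open>At \<open>s = 1\<close> the order of the pole of the L-function, where a zero counts as \<open>-1\<close> whatever its multiplicity.\<close>

definition dchar_order :: "nat \<Rightarrow> (nat \<Rightarrow> complex) \<Rightarrow> real" where
  "dchar_order m \<eta> = (if \<eta> = principal_dchar m then 1 else if dchar_L \<eta> = 0 then -1 else 0)"

lemma dchar_A_asymp:
  assumes "dchar m \<eta>" "m > 0"
  shows "\<exists>B. \<forall>N>0. norm (dchar_A \<eta> N - of_real (dchar_order m \<eta> * ln (real N))) \<le> B"
proof -
  consider "\<eta> = principal_dchar m" | "\<eta> \<noteq> principal_dchar m" "dchar_L \<eta> = 0"
    | "\<eta> \<noteq> principal_dchar m" "dchar_L \<eta> \<noteq> 0" by blast
  thus ?thesis
  proof cases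
    case 1
    thus ?thesis using dchar_A_principal_bounded[OF assms(2)] by (auto simp: dchar_order_def)
  next
    case 2
    thus ?thesis using dchar_A_zero_bounded[OF assms(1) 2(1) assms(2) 2(2)] by (auto simp: dchar_order_def)
  next
    case 3
    obtain B where B: "\<And>N. N > 0 \<Longrightarrow> norm (dchar_L \<eta> * dchar_A \<eta> N) \<le> B"
      using dchar_A_L_bounded[OF assms(1) 3(1) assms(2)] by blast
    have "norm (dchar_A \<eta> N) \<le> B / norm (dchar_L \<eta>)" if "N > 0" for N
      using B[OF that] 3 by (simp add: norm_mult field_simps)
    thus ?thesis using 3 by (auto simp: dchar_order_def)
  qed
qed

text \<open>Orthogonality combined with the asymptotics of every \<open>dchar_A\<close>. The
  coefficient of ln N stays a sum over characters because nonvanishing is still open: the case a = 1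
  proves it, and afterwards the coefficient is 1.\<close>

lemma sum_mangoldt_residue_asymp:
  assumes m: "squarefree m" "m > 1" and a: "coprime a m"
  shows "\<exists>B. \<forall>N>0. \<bar>real (totient m) * (\<Sum>n | n \<in> {1..N} \<and> [n = a] (mod m). mangoldt n / real n)
            - Re (\<Sum>\<eta> | dchar m \<eta>. cnj (\<eta> a) * dchar_order m \<eta>) * ln (real N)\<bar> \<le> B"
proof -
  have m0: "m > 0" using m by simp
  \<comment> \<open>The inverse b of a replaces conjugation: cnj (\<eta> a) = \<eta> b, and \<eta> b
    * \<eta> n = \<eta> (b * n) selects the n with b n = 1 (mod m).\<close>
  obtain b where b: "[a * b = 1] (mod m)" using a cong_solve_coprime_nat[of a m] by auto
  have copb: "coprime b m" 
  proof -
    have "coprime (a * b) m" using cong_imp_coprime[OF cong_sym[OF b]] by simp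
    thus ?thesis by simp
  qed
  have cnj: "cnj (\<eta> a) = \<eta> b" if "dchar m \<eta>" for \<eta>
  proof -
    have "\<eta> a * \<eta> b = 1" using dchar_cong[OF that b] dchar_1[OF that] dchar_mult[OF that] by simp
    moreover have "\<eta> a * cnj (\<eta> a) = 1"
      using norm_dchar[OF that m0, of a] a by (simp add: complex_norm_square[symmetric])
    ultimately have "\<eta> a * cnj (\<eta> a) = \<eta> a * \<eta> b" and "\<eta> a \<noteq> 0" by auto
    thus ?thesis by simp
  qed
  have "\<exists>B. \<forall>\<eta>. dchar m \<eta> \<longrightarrow> (\<forall>N>0. norm (dchar_A \<eta> N - of_real (dchar_order m \<eta> * ln (real N))) \<le> B \<eta>)"
    using dchar_A_asymp[OF _ m0] by meson
  then obtain B where B: "\<And>\<eta> N. dchar m \<eta> \<Longrightarrow> N > 0 \<Longrightarrow>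
      norm (dchar_A \<eta> N - of_real (dchar_order m \<eta> * ln (real N))) \<le> B \<eta>" by blast
  have "\<bar>real (totient m) * (\<Sum>n | n \<in> {1..N} \<and> [n = a] (mod m). mangoldt n / real n)
            - Re (\<Sum>\<eta> | dchar m \<eta>. cnj (\<eta> a) * dchar_order m \<eta>) * ln (real N)\<bar> \<le> (\<Sum>\<eta> | dchar m \<eta>. B \<eta>)"
    if N: "N > 0" for N
  proof -
    have "(\<Sum>\<eta> | dchar m \<eta>. \<eta> b * dchar_A \<eta> N)
        = (\<Sum>n=1..N. (\<Sum>\<eta> | dchar m \<eta>. \<eta> (b * n)) * (mangoldt n / of_nat n))"
      unfolding dchar_A_def sum_distrib_left sum_distrib_right
      by (subst sum.swap) (auto intro!: sum.cong simp: dchar_mult)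
    also have "\<dots> = (\<Sum>n=1..N. if [n = a] (mod m) then of_nat (totient m) * (mangoldt n / of_nat n) else 0)"
    proof (rule sum.cong)
      fix n
      have "[b * n = 1] (mod m) \<longleftrightarrow> [b * n = b * a] (mod m)"
        using b by (metis cong_sym cong_trans mult.commute)
      also have "\<dots> \<longleftrightarrow> [n = a] (mod m)" using copb by (simp add: cong_mult_lcancel_nat)
      finally show "(\<Sum>\<eta> | dchar m \<eta>. \<eta> (b * n)) * (mangoldt n / of_nat n) =
          (if [n = a] (mod m) then of_nat (totient m) * (mangoldt n / of_nat n) else 0)"
        by (simp add: sum_dchars[OF m])
    qed auto
    also have "\<dots> = of_nat (totient m) * (\<Sum>n | n \<in> {1..N} \<and> [n = a] (mod m). mangoldt n / of_nat n)"
      unfolding sum_distrib_left by (rule sum.inter_filter[symmetric]) auto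
    also have "\<dots> = of_real (real (totient m) * (\<Sum>n | n \<in> {1..N} \<and> [n = a] (mod m). mangoldt n / real n))"
      by simp
    finally have eq: "(\<Sum>\<eta> | dchar m \<eta>. \<eta> b * dchar_A \<eta> N)
        = of_real (real (totient m) * (\<Sum>n | n \<in> {1..N} \<and> [n = a] (mod m). mangoldt n / real n))" .
    have "norm ((\<Sum>\<eta> | dchar m \<eta>. \<eta> b * dchar_A \<eta> N)
            - (\<Sum>\<eta> | dchar m \<eta>. cnj (\<eta> a) * dchar_order m \<eta>) * ln (real N))
        = norm (\<Sum>\<eta> | dchar m \<eta>. \<eta> b * (dchar_A \<eta> N - of_real (dchar_order m \<eta> * ln (real N))))"
      unfolding sum_distrib_right sum_subtractf[symmetric]
      by (intro arg_cong[where f = norm] sum.cong) (auto simp: cnj algebra_simps)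
    also have "\<dots> \<le> (\<Sum>\<eta> | dchar m \<eta>. B \<eta>)"
    proof (rule sum_norm_le)
      fix \<eta> assume "\<eta> \<in> {\<eta>. dchar m \<eta>}"
      hence \<eta>: "dchar m \<eta>" by simp
      thus "norm (\<eta> b * (dchar_A \<eta> N - of_real (dchar_order m \<eta> * ln (real N)))) \<le> B \<eta>"
        using norm_dchar[OF \<eta> m0, of b] copb B[OF \<eta> N] by (simp add: norm_mult)
    qed
    finally have 1: "norm ((\<Sum>\<eta> | dchar m \<eta>. \<eta> b * dchar_A \<eta> N)
            - (\<Sum>\<eta> | dchar m \<eta>. cnj (\<eta> a) * dchar_order m \<eta>) * ln (real N)) \<le> (\<Sum>\<eta> | dchar m \<eta>. B \<eta>)" .
    have "Re ((\<Sum>\<eta> | dchar m \<eta>. \<eta> b * dchar_A \<eta> N)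
            - (\<Sum>\<eta> | dchar m \<eta>. cnj (\<eta> a) * dchar_order m \<eta>) * ln (real N))
        = real (totient m) * (\<Sum>n | n \<in> {1..N} \<and> [n = a] (mod m). mangoldt n / real n)
            - Re (\<Sum>\<eta> | dchar m \<eta>. cnj (\<eta> a) * dchar_order m \<eta>) * ln (real N)"
      unfolding eq by simp
    hence "\<bar>real (totient m) * (\<Sum>n | n \<in> {1..N} \<and> [n = a] (mod m). mangoldt n / real n)
            - Re (\<Sum>\<eta> | dchar m \<eta>. cnj (\<eta> a) * dchar_order m \<eta>) * ln (real N)\<bar>
        \<le> norm ((\<Sum>\<eta> | dchar m \<eta>. \<eta> b * dchar_A \<eta> N)
            - (\<Sum>\<eta> | dchar m \<eta>. cnj (\<eta> a) * dchar_order m \<eta>) * ln (real N))"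
      by (metis abs_Re_le_cmod)
    thus ?thesis using 1 by (rule order_trans)
  qed
  thus ?thesis by blast
qed

lemma dchar_L_cnj:
  assumes "dchar m \<eta>" "\<eta> \<noteq> principal_dchar m" "m > 0"
  shows "dchar_L (\<lambda>n. cnj (\<eta> n)) = cnj (dchar_L \<eta>)"
proof -
  have "(\<lambda>K. cnj (\<Sum>k=1..K. \<eta> k / of_nat k)) \<longlonglongrightarrow> cnj (dchar_L \<eta>)"
    by (intro tendsto_cnj dchar_L_LIMSEQ[OF assms])
  thus ?thesis unfolding dchar_L_def[of "\<lambda>n. cnj (\<eta> n)"] by (intro limI) simp
qed

text \<open>A complex character and its conjugate would contribute two zeros, which makes the (nonnegative)
  sum over the residue class 1 tend to minus infinity.\<close>

lemma dchar_L_nonzero: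
  assumes m: "squarefree m" "m > 1" and \<eta>: "dchar m \<eta>" "\<eta> \<noteq> principal_dchar m"
  shows "dchar_L \<eta> \<noteq> 0"
proof
  assume L0: "dchar_L \<eta> = 0"
  have m0: "m > 0" using m by simp
  define \<psi> where "\<psi> n = cnj (\<eta> n)" for n
  have \<psi>: "dchar m \<psi>" unfolding \<psi>_def by (rule dchar_cnj[OF \<eta>(1)])
  have \<psi>0: "\<psi> \<noteq> principal_dchar m"
  proof
    assume "\<psi> = principal_dchar m"
    hence "cnj (\<eta> n) = principal_dchar m n" for n unfolding \<psi>_def by (rule fun_cong)
    hence "cnj (cnj (\<eta> n)) = cnj (principal_dchar m n)" for n by (rule arg_cong)
    hence "\<eta> n = principal_dchar m n" for n by (simp add: principal_dchar_def split: if_splits)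
    hence "\<eta> = principal_dchar m" by (rule ext)
    thus False using \<eta>(2) by contradiction
  qed
  have L\<psi>: "dchar_L \<psi> = 0" unfolding \<psi>_def using dchar_L_cnj[OF \<eta> m0] L0 by simp
  have ne: "\<psi> \<noteq> \<eta>"
  proof
    assume "\<psi> = \<eta>"
    hence "cnj (\<eta> n) = \<eta> n" for n unfolding \<psi>_def by (rule fun_cong)
    hence "\<eta> n \<in> \<real>" for n by (simp add: Reals_cnj_iff)
    thus False using dchar_L_real_nonzero[OF \<eta> m0] L0 by blast
  qed
  let ?e = "\<Sum>\<rho> | dchar m \<rho>. dchar_order m \<rho>"
  \<comment> \<open>The principal character counts 1, \<eta> and its conjugate count -1 each, and
    every other character 0 or -1.\<close>
  have "?e \<le> -1"
  proof -
    let ?T = "{principal_dchar m, \<eta>, \<psi>}"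
    have "?e = sum (dchar_order m) ?T + sum (dchar_order m) ({\<rho>. dchar m \<rho>} - ?T)"
      using finite_dchars[OF m0] dchar_principal[OF m0] \<eta> \<psi> by (subst sum.subset_diff[of ?T]) auto
    moreover have "sum (dchar_order m) ({\<rho>. dchar m \<rho>} - ?T) \<le> 0"
      by (intro sum_nonpos) (auto simp: dchar_order_def)
    moreover have "sum (dchar_order m) ?T = -1"
      using \<eta>(2) \<psi>0 ne L0 L\<psi> by (simp add: dchar_order_def)
    ultimately show ?thesis by linarith
  qed
  moreover have "(\<Sum>\<rho> | dchar m \<rho>. cnj (\<rho> 1) * dchar_order m \<rho>) = of_real ?e"
    by (simp add: dchar_1)
  ultimately have Re: "Re (\<Sum>\<rho> | dchar m \<rho>. cnj (\<rho> 1) * dchar_order m \<rho>) \<le> -1" by simp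
  obtain B where B: "\<And>N. N > 0 \<Longrightarrow> \<bar>real (totient m) * (\<Sum>n | n \<in> {1..N} \<and> [n = 1] (mod m). mangoldt n / real n)
            - Re (\<Sum>\<eta> | dchar m \<eta>. cnj (\<eta> 1) * dchar_order m \<eta>) * ln (real N)\<bar> \<le> B"
    using sum_mangoldt_residue_asymp[OF m, of 1] by auto
  have "ln (real N) \<le> B" if "N > 0" for N
  proof -
    have "0 \<le> real (totient m) * (\<Sum>n | n \<in> {1..N} \<and> [n = 1] (mod m). mangoldt n / real n)"
      by (intro mult_nonneg_nonneg sum_nonneg) (auto simp: mangoldt_nonneg)
    moreover have "Re (\<Sum>\<eta> | dchar m \<eta>. cnj (\<eta> 1) * dchar_order m \<eta>) * ln (real N) \<le> -1 * ln (real N)"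
      using Re that by (intro mult_right_mono) auto
    ultimately show ?thesis using B[OF that] by linarith
  qed
  moreover have "\<exists>N>0. ln (real N) > B"
  proof -
    obtain N where "real N > exp B" using reals_Archimedean2 by blast
    moreover from this have "N > 0" using exp_gt_zero[of B] by (cases N) auto
    ultimately show ?thesis by (metis exp_less_cancel_iff exp_ln of_nat_0_less_iff)
  qed
  ultimately show False by (meson not_le)
qed

text \<open>By nonvanishing only the principal character contributes to ln N, and proper prime
  powers go into the bound. B depends on m and a without control, so one common bound is available
  only for finitely many moduli.\<close>

theorem mertens_residue_class:
  assumes m: "squarefree m" "m > 1" and a: "coprime a m"
  obtains B where "\<And>N. N > 0 \<Longrightarrow>
    \<bar>(\<Sum>p | p \<in> {1..N} \<and> prime p \<and> [p = a] (mod m). ln (real p) / real p) - ln (real N) / real (totient m)\<bar> \<le> B"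
proof -
  have m0: "m > 0" using m by simp
  have "(\<Sum>\<eta> | dchar m \<eta>. cnj (\<eta> a) * dchar_order m \<eta>) = (\<Sum>\<eta>\<in>{principal_dchar m}. cnj (\<eta> a) * dchar_order m \<eta>)"
    using finite_dchars[OF m0] dchar_principal[OF m0] dchar_L_nonzero[OF m]
    by (intro sum.mono_neutral_right) (auto simp: dchar_order_def)
  also have "\<dots> = 1" using a by (simp add: dchar_order_def principal_dchar_def)
  finally have e: "(\<Sum>\<eta> | dchar m \<eta>. cnj (\<eta> a) * dchar_order m \<eta>) = 1" .
  obtain B where B: "\<And>N. N > 0 \<Longrightarrow>
    \<bar>real (totient m) * (\<Sum>n | n \<in> {1..N} \<and> [n = a] (mod m). mangoldt n / real n) - ln (real N)\<bar> \<le> B"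
    using sum_mangoldt_residue_asymp[OF m a] unfolding e by auto
  obtain C where C: "\<And>N. (\<Sum>d | d \<in> {1..N} \<and> \<not> prime d. mangoldt d / real d) \<le> (C::real)"
    using sum_mangoldt_nonprime_bounded by blast
  show ?thesis
  proof (rule that)
    fix N :: nat assume N: "N > 0"
    let ?X = "\<Sum>n | n \<in> {1..N} \<and> [n = a] (mod m). mangoldt n / real n :: real"
    let ?Y = "\<Sum>p | p \<in> {1..N} \<and> prime p \<and> [p = a] (mod m). ln (real p) / real p"
    let ?Z = "\<Sum>n | n \<in> {1..N} \<and> \<not> prime n \<and> [n = a] (mod m). mangoldt n / real n :: real"
    have "?X = (\<Sum>p | p \<in> {1..N} \<and> prime p \<and> [p = a] (mod m). mangoldt p / real p) + ?Z"
      by (subst sum.union_disjoint[symmetric]) (auto intro!: sum.cong)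
    also have "(\<Sum>p | p \<in> {1..N} \<and> prime p \<and> [p = a] (mod m). mangoldt p / real p) = ?Y"
      by (rule sum.cong) auto
    finally have X: "?X = ?Y + ?Z" .
    have "?Z \<le> (\<Sum>d | d \<in> {1..N} \<and> \<not> prime d. mangoldt d / real d)"
      by (rule sum_mono2) (auto simp: mangoldt_nonneg)
    hence Z: "0 \<le> ?Z" "?Z \<le> C" using C[of N] by (auto intro!: sum_nonneg simp: mangoldt_nonneg)
    have t: "real (totient m) > 0" using m0 by simp
    have "\<bar>?X - ln (real N) / real (totient m)\<bar> = \<bar>real (totient m) * ?X - ln (real N)\<bar> / real (totient m)"
    proof -
      have "x - l / u = (u * x - l) / u" if "u > 0" for x l u :: real using that by (simp add: field_simps)
      from this[OF t] show ?thesis using t by (simp only: abs_divide abs_of_pos)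
    qed
    also have "\<dots> \<le> B / real (totient m)" using B[OF N] t by (intro divide_right_mono) auto
    finally show "\<bar>?Y - ln (real N) / real (totient m)\<bar> \<le> B / real (totient m) + C"
      using X Z by linarith
  qed
qed

section \<open>Density of the ratios\<close>

lemma prod_one_minus_ge:
  fixes x :: "'a \<Rightarrow> real"
  assumes "finite A" "\<And>i. i \<in> A \<Longrightarrow> 0 \<le> x i \<and> x i \<le> 1"
  shows "1 - (\<Sum>i\<in>A. x i) \<le> (\<Prod>i\<in>A. 1 - x i)"
  using assms
proof (induction A rule: finite_induct)
  case (insert a A)
  have "1 - (\<Sum>i\<in>insert a A. x i) = (1 - (\<Sum>i\<in>A. x i)) - x a" using insert by simp
  also have "\<dots> \<le> (\<Prod>i\<in>A. 1 - x i) - x a * (\<Prod>i\<in>A. 1 - x i)"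
  proof -
    have "(\<Prod>i\<in>A. 1 - x i) \<le> 1" using insert by (intro prod_le_1) auto
    hence "x a * (\<Prod>i\<in>A. 1 - x i) \<le> x a * 1" using insert by (intro mult_left_mono) auto
    thus ?thesis using insert by auto
  qed
  also have "\<dots> = (\<Prod>i\<in>insert a A. 1 - x i)" using insert by (simp add: algebra_simps)
  finally show ?case .
qed auto

text \<open>Mertens' theorem modulo 2 concerns the odd primes, with \<open>totient 2\<close> = 1.
  Once ln w >= 2 (B + D), where D collects the primes up to y, at least half of ln w comes from the
  primes in (y, w]; there ln p <= ln w passes from (ln p)/p to 1/p.\<close>

lemma exists_sum_inverse_primes_ge:
  assumes "y \<ge> 2"
  shows "\<exists>w\<ge>y. (\<Sum>p | prime p \<and> p \<in> {y<..w}. 1 / real p) \<ge> 1 / 2"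
proof -
  obtain B where B: "\<And>N. N > 0 \<Longrightarrow>
    \<bar>(\<Sum>p | p \<in> {1..N} \<and> prime p \<and> [p = 1] (mod 2). ln (real p) / real p) - ln (real N) / real (totient 2)\<bar> \<le> B"
  proof -
    have "squarefree (2::nat)" by (rule squarefree_prime) simp
    thus ?thesis using mertens_residue_class[of 2 1] that by auto
  qed
  define D where "D = (\<Sum>p | p \<in> {1..y} \<and> prime p \<and> [p = 1] (mod 2). ln (real p) / real p)"
  obtain w0 where w0: "real w0 > exp (2 * (B + D))" using reals_Archimedean2 by blast
  define w where "w = max y w0"
  have w: "w \<ge> y" "w \<ge> 2" using assms by (auto simp: w_def)
  have "exp (2 * (B + D)) \<le> real w" using w0 by (simp add: w_def)
  hence lnw: "2 * (B + D) \<le> ln (real w)" using w by (simp add: ln_ge_iff)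
  have lnpos: "ln (real w) > 0" using w by simp
  have "ln (real w) - B \<le> (\<Sum>p | p \<in> {1..w} \<and> prime p \<and> [p = 1] (mod 2). ln (real p) / real p)"
    using B[of w] w by simp
  also have "\<dots> = D + (\<Sum>p | p \<in> {y<..w} \<and> prime p \<and> [p = 1] (mod 2). ln (real p) / real p)"
    unfolding D_def using w by (subst sum.union_disjoint[symmetric]) (auto intro!: sum.cong)
  finally have "ln (real w) / 2 \<le> (\<Sum>p | p \<in> {y<..w} \<and> prime p \<and> [p = 1] (mod 2). ln (real p) / real p)"
    using lnw by argo
  also have "\<dots> \<le> (\<Sum>p | prime p \<and> p \<in> {y<..w}. ln (real p) / real p)"
    by (rule sum_mono2) (auto intro: prime_gt_0_nat)
  also have "\<dots> \<le> (\<Sum>p | prime p \<and> p \<in> {y<..w}. ln (real w) * (1 / real p))"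
    by (rule sum_mono) (auto simp: divide_right_mono prime_gt_0_nat)
  also have "\<dots> = ln (real w) * (\<Sum>p | prime p \<and> p \<in> {y<..w}. 1 / real p)" by (simp add: sum_distrib_left)
  finally have "1 / 2 \<le> (\<Sum>p | prime p \<and> p \<in> {y<..w}. 1 / real p)"
    using lnpos by (simp add: field_simps)
  thus ?thesis using w by blast
qed

definition euler_prod :: "nat \<Rightarrow> nat \<Rightarrow> real" where
  "euler_prod y w = (\<Prod>p | prime p \<and> p \<in> {y<..w}. 1 - 1 / real p)"

lemma euler_prod_nonneg: "0 \<le> euler_prod y w"
  unfolding euler_prod_def by (intro prod_nonneg) (auto dest: prime_gt_0_nat)

lemma euler_prod_mult:
  assumes "y \<le> u" "u \<le> w"
  shows "euler_prod y w = euler_prod y u * euler_prod u w"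
proof -
  have "{p. prime p \<and> p \<in> {y<..w}} = {p. prime p \<and> p \<in> {y<..u}} \<union> {p. prime p \<and> p \<in> {u<..w}}"
    using assms by auto
  thus ?thesis unfolding euler_prod_def by (simp only:) (rule prod.union_disjoint, auto)
qed

lemma euler_prod_le_exp: "euler_prod y w \<le> exp (- (\<Sum>p | prime p \<and> p \<in> {y<..w}. 1 / real p))"
proof -
  have "euler_prod y w \<le> (\<Prod>p | prime p \<and> p \<in> {y<..w}. exp (- (1 / real p)))"
    unfolding euler_prod_def
  proof (rule prod_mono)
    fix p assume p: "p \<in> {p. prime p \<and> p \<in> {y<..w}}"
    have "1 + (- (1 / real p)) \<le> exp (- (1 / real p))" by (rule exp_ge_add_one_self)
    thus "0 \<le> 1 - 1 / real p \<and> 1 - 1 / real p \<le> exp (- (1 / real p))"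
      using p by (auto dest: prime_gt_0_nat)
  qed
  also have "\<dots> = exp (- (\<Sum>p | prime p \<and> p \<in> {y<..w}. 1 / real p))"
    by (subst exp_sum[symmetric]) (auto simp: sum_negf)
  finally show ?thesis .
qed

text \<open>Each further block of primes whose reciprocals sum to at least 1/2 multiplies the
  product by at most exp (-1/2).\<close>

lemma euler_prod_small:
  assumes "y \<ge> 2" "\<delta> > 0"
  shows "\<exists>w\<ge>y. euler_prod y w \<le> \<delta>"
proof -
  have "\<exists>w\<ge>y. euler_prod y w \<le> exp (- real k / 2)" for k
  proof (induction k)
    case 0
    show ?case by (rule exI[of _ y]) (simp add: euler_prod_def)
  next
    case (Suc k)
    then obtain u where u: "u \<ge> y" "euler_prod y u \<le> exp (- real k / 2)" by blast
    then obtain w where w: "w \<ge> u" "(\<Sum>p | prime p \<and> p \<in> {u<..w}. 1 / real p) \<ge> 1 / 2"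
      using exists_sum_inverse_primes_ge[of u] assms by auto
    have "euler_prod u w \<le> exp (- (1/2))"
      using euler_prod_le_exp[of u w] w(2) order_trans by fastforce
    hence "euler_prod y w \<le> exp (- real k / 2) * exp (- (1/2))"
      unfolding euler_prod_mult[OF u(1) w(1)] using u by (intro mult_mono euler_prod_nonneg) auto
    also have "\<dots> = exp (- real (Suc k) / 2)" unfolding exp_add[symmetric] by (simp add: field_simps)
    finally show ?case using u w by (intro exI[of _ w]) auto
  qed
  moreover obtain k where "real k > - 2 * ln \<delta>" using reals_Archimedean2 by blast
  moreover from this have "exp (- real k / 2) \<le> exp (ln \<delta>)" by simp
  ultimately show ?thesis using assms(2) by (metis exp_ln order_trans)
qed

text \<open>w is the least bound at which the product drops to \<alpha> or below. The last factor is
  at least 1 - 1/y, so the drop cannot overshoot by more than that.\<close>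

lemma euler_prod_approx:
  assumes "0 < \<alpha>" "\<alpha> \<le> 1" "y \<ge> 2"
  shows "\<exists>w\<ge>y. euler_prod y w \<le> \<alpha> \<and> \<alpha> * (1 - 1 / real y) \<le> euler_prod y w"
proof -
  define w where "w = (LEAST w. w \<ge> y \<and> euler_prod y w \<le> \<alpha>)"
  have w: "w \<ge> y \<and> euler_prod y w \<le> \<alpha>"
    unfolding w_def using euler_prod_small[OF assms(3,1)] by (metis (mono_tags, lifting) LeastI_ex)
  have "\<alpha> * (1 - 1 / real y) \<le> euler_prod y w"
  proof (cases "w = y")
    case True
    hence "euler_prod y w = 1" by (simp add: euler_prod_def)
    moreover have "\<alpha> * (1 - 1 / real y) \<le> 1 * 1" using assms by (intro mult_mono) auto
    ultimately show ?thesis by simp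
  next
    case False
    then obtain v where v: "w = Suc v" "v \<ge> y" using w by (cases w) auto
    have "\<not> (v \<ge> y \<and> euler_prod y v \<le> \<alpha>)"
      by (rule not_less_Least) (use v in \<open>simp add: w_def[symmetric]\<close>)
    hence gt: "euler_prod y v > \<alpha>" using v by auto
    have "euler_prod v w \<ge> 1 - 1 / real y"
    proof (cases "prime w")
      case True
      hence "{p. prime p \<and> p \<in> {v<..w}} = {w}" using v by auto
      moreover have "1 / real w \<le> 1 / real y" using w assms by (intro divide_left_mono) auto
      ultimately show ?thesis by (simp add: euler_prod_def)
    next
      case False
      hence "{p. prime p \<and> p \<in> {v<..w}} = {}" using v by (auto simp: le_Suc_eq)
      hence "euler_prod v w = 1" by (simp only: euler_prod_def prod.empty)
      thus ?thesis by simp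
    qed
    hence "\<alpha> * (1 - 1 / real y) \<le> euler_prod y v * euler_prod v w"
      using gt assms by (intro mult_mono euler_prod_nonneg) auto
    thus ?thesis using euler_prod_mult[of y v w] v by simp
  qed
  thus ?thesis using w by blast
qed

text \<open>The sum telescopes. Its summand is the weight 1/q of q in E times the frequency 1/(q -
  1) of q dividing p + 1.\<close>

lemma sum_inverse_pronic_le:
  assumes "z > 0"
  shows "(\<Sum>q | prime q \<and> q \<in> {z<..Z}. 1 / (real q * (real q - 1))) \<le> 1 / real z"
proof (cases "z \<le> Z")
  case True
  have "(\<Sum>q | prime q \<and> q \<in> {z<..Z}. 1 / (real q * (real q - 1))) \<le> (\<Sum>q\<in>{z<..Z}. 1 / (real q * (real q - 1)))"
    using assms by (intro sum_mono2) auto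
  also have "\<dots> = 1 / real z - 1 / real Z"
    using True
  proof (induction Z rule: dec_induct)
    case (step n)
    have "{z<..Suc n} = insert (Suc n) {z<..n}" using step by auto
    hence "(\<Sum>q\<in>{z<..Suc n}. 1 / (real q * (real q - 1))) = 1 / (real (Suc n) * real n) + (1 / real z - 1 / real n)"
      using step by simp
    also have "1 / (real (Suc n) * real n) = 1 / real n - 1 / real (Suc n)"
      using step assms by (simp add: field_simps)
    finally show ?case by simp
  qed auto
  also have "\<dots> \<le> 1 / real z" by simp
  finally show ?thesis .
qed auto

section \<open>Averaging the large prime factors of p + 1 over a residue class\<close>

definition primorial :: "nat \<Rightarrow> nat" where
  "primorial z = \<Prod>{p. prime p \<and> p \<le> z}"

lemma finite_primes_le [simp]: "finite {p::nat. prime p \<and> p \<le> z}"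
  by (rule finite_subset[of _ "{..z}"]) auto

lemma squarefree_primorial: "squarefree (primorial z)"
  unfolding primorial_def
  by (rule squarefree_prod_coprime) (auto intro: primes_coprime squarefree_prime)

lemma primorial_gt_1: "z \<ge> 2 \<Longrightarrow> primorial z > 1"
proof -
  assume "z \<ge> 2"
  hence "2 dvd primorial z" unfolding primorial_def by (intro dvd_prodI[where f = "\<lambda>x. x"]) auto
  moreover have "primorial z \<noteq> 0" using squarefree_primorial[of z] by (metis not_squarefree_0)
  ultimately show ?thesis by (auto dest: dvd_imp_le)
qed

lemma coprime_primorial:
  assumes "prime q" "q > z"
  shows "coprime q (primorial z)"
  unfolding primorial_def using assms by (intro prod_coprime_right) (auto intro: primes_coprime)

text \<open>The quantity E(p) is this sum at n = p + 1, with z = w.\<close>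

definition large_factor_sum :: "nat \<Rightarrow> nat \<Rightarrow> real" where
  "large_factor_sum z n = (\<Sum>q | prime q \<and> z < q \<and> q dvd n. 1 / real q)"

text \<open>The conditions modulo the primorial P and modulo q merge into one class modulo P q, as q
  > z is prime to P. The modulus is again squarefree, and its totient is that of P times q - 1. B
  may depend on q.\<close>

lemma residue_and_neg1_asymp:
  assumes z: "z \<ge> 2" and a: "coprime a (primorial z)" and q: "prime q" "q > z"
  shows "\<exists>B. \<forall>N>0. (\<Sum>p | p \<in> {1..N} \<and> prime p \<and> [p = a] (mod primorial z) \<and> q dvd p + 1. ln (real p) / real p)
           \<le> ln (real N) / (real (totient (primorial z)) * (real q - 1)) + B"
proof -
  let ?P = "primorial z"
  have cop: "coprime ?P q" using coprime_primorial[OF q] by (simp add: coprime_commute)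
  obtain c where c: "[c = a] (mod ?P)" "[c = q - 1] (mod q)"
    using binary_chinese_remainder_nat[OF cop] by blast
  have q1: "q > 1" using q(1) prime_gt_1_nat by blast
  have "coprime (q - 1) q" using q1 by (intro coprime_diff_one_left_nat) auto
  hence "coprime c q" using c(2) cong_imp_coprime cong_sym by blast
  moreover have "coprime c ?P" using c(1) a cong_imp_coprime cong_sym by blast
  ultimately have copc: "coprime c (?P * q)" by simp
  have sq: "squarefree (?P * q)"
    by (rule squarefree_mult_coprime[OF cop squarefree_primorial squarefree_prime[OF q(1)]])
  have gt: "?P * q > 1" using primorial_gt_1[OF z] q1 by (metis less_1_mult)
  obtain B where B: "\<And>N. N > 0 \<Longrightarrow>
    \<bar>(\<Sum>p | p \<in> {1..N} \<and> prime p \<and> [p = c] (mod (?P * q)). ln (real p) / real p) - ln (real N) / real (totient (?P * q))\<bar> \<le> B"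
    using mertens_residue_class[OF sq gt copc] by blast
  have tot: "real (totient (?P * q)) = real (totient ?P) * (real q - 1)"
    using cop q q1 by (simp add: totient_mult_coprime totient_prime of_nat_diff)
  have iff: "[p = c] (mod (?P * q)) \<longleftrightarrow> [p = a] (mod ?P) \<and> q dvd p + 1" for p
  proof -
    have "[p = c] (mod (?P * q)) \<longleftrightarrow> [p = c] (mod ?P) \<and> [p = c] (mod q)"
      using cop by (meson coprime_cong_mult_nat cong_modulus_mult_nat cong_modulus_mult_nat mult.commute cong_dvd_modulus_nat dvd_triv_left dvd_triv_right)
    also have "[p = c] (mod ?P) \<longleftrightarrow> [p = a] (mod ?P)" using c(1) cong_trans cong_sym by blast
    also have "[p = c] (mod q) \<longleftrightarrow> [p = q - 1] (mod q)" using c(2) cong_trans cong_sym by blast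
    also have "\<dots> \<longleftrightarrow> [p + 1 = q - 1 + 1] (mod q)" by (simp only: cong_add_rcancel_nat)
    also have "\<dots> \<longleftrightarrow> q dvd p + 1" using q1 by (simp add: cong_def dvd_eq_mod_eq_0)
    finally show ?thesis .
  qed
  have "(\<Sum>p | p \<in> {1..N} \<and> prime p \<and> [p = a] (mod ?P) \<and> q dvd p + 1. ln (real p) / real p)
      \<le> ln (real N) / (real (totient ?P) * (real q - 1)) + B" if "N > 0" for N
    using B[OF that] unfolding iff tot by linarith
  thus ?thesis by blast
qed

text \<open>If E(p) >= \<delta> for all p > X in the class, the weighted sum of E over p <= N is at
  least about \<delta> (ln N) / t, with t the totient of the primorial. It is also at most about (ln
  N) / (z t) plus a small multiple of ln N, against 1/z < \<delta>.\<close>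

lemma exists_prime_small_large_factor_sum:
  assumes z: "z \<ge> 2" and a: "coprime a (primorial z)" and \<delta>: "1 / real z < \<delta>"
  shows "\<exists>p>X. prime p \<and> [p = a] (mod primorial z) \<and> large_factor_sum z (p + 1) < \<delta>"
proof (rule ccontr)
  assume neg: "\<not> ?thesis"
  let ?P = "primorial z"
  let ?C = "\<lambda>N. {p. p \<in> {1..N} \<and> prime p \<and> [p = a] (mod ?P)}"
  let ?w = "\<lambda>p::nat. ln (real p) / real p"
  let ?W = "\<lambda>q N. \<Sum>p | p \<in> {1..N} \<and> prime p \<and> [p = a] (mod ?P) \<and> q dvd p + 1. ?w p"
  define t where "t = real (totient ?P)"
  have t: "t > 0" using primorial_gt_1[OF z] by (simp add: t_def)
  have \<delta>0: "\<delta> > 0" using \<delta> z by (metis divide_pos_pos less_trans of_nat_0_less_iff pos2 order_less_le_trans zero_less_one)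
  have w0: "?w p \<ge> 0" if "p > 0" for p using that by simp
  obtain B0 where B0: "\<And>N. N > 0 \<Longrightarrow> \<bar>(\<Sum>p\<in>?C N. ?w p) - ln (real N) / t\<bar> \<le> B0"
    using mertens_residue_class[OF squarefree_primorial primorial_gt_1[OF z] a] unfolding t_def by blast
  have "\<exists>B. \<forall>q. prime q \<and> q > z \<longrightarrow> (\<forall>N>0. ?W q N \<le> ln (real N) / (t * (real q - 1)) + B q)"
    using residue_and_neg1_asymp[OF z a] unfolding t_def by meson
  then obtain B where B: "\<And>q N. prime q \<Longrightarrow> q > z \<Longrightarrow> N > 0 \<Longrightarrow> ?W q N \<le> ln (real N) / (t * (real q - 1)) + B q"
    by blast
  \<comment> \<open>The two coefficients of ln N differ by (\<delta> - 1/z) / t = 24 \<kappa>. The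
    primes q > Z take 12 \<kappa> of it, with the 12 of \<open>theta_neg1_le\<close>, and 12
    \<kappa> is left.\<close>
  define \<kappa> where "\<kappa> = (\<delta> - 1 / real z) / (24 * t)"
  have \<kappa>: "\<kappa> > 0" using \<delta> t by (simp add: \<kappa>_def)
  obtain Z0 where Z0: "\<And>m n. m \<ge> Z0 \<Longrightarrow> norm (\<Sum>q\<in>{m..<n}. ln (real q) / real q ^ 2) < \<kappa>"
    using summable_ln_over_square \<kappa> unfolding summable_Cauchy by blast
  \<comment> \<open>Up to Z the Mertens errors \<open>B q\<close> are finitely many and add up to
    the constant \<open>B'\<close>; beyond Z the tail of the series is below \<kappa>. The 3 secures
    q >= 3 for the Chebyshev bound.\<close>
  define Z where "Z = max Z0 (max z 3)"
  have Z: "Z \<ge> Z0" "Z \<ge> z" "Z \<ge> 3" by (auto simp: Z_def)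
  define S where "S = (\<Sum>p\<in>?C X. ?w p)"
  define B' where "B' = (\<Sum>q | prime q \<and> q \<in> {z<..Z}. B q / real q)"
  have bound: "ln (real N) * (\<delta> / t - 1 / (real z * t) - 12 * \<kappa>) \<le> \<delta> * (B0 + S) + B' + 24 * \<kappa>" if N: "N > Z" for N
  proof -
    have N0: "N > 0" using N by simp
    have lnN: "ln (real N) \<ge> 0" using N0 by simp
    let ?Q = "{q. prime q \<and> q \<in> {z<..N + 1}}"
    have lower: "\<delta> * (ln (real N) / t - B0 - S) \<le> (\<Sum>p\<in>?C N. large_factor_sum z (p + 1) * ?w p)"
    proof -
      have "(\<Sum>p\<in>?C N. ?w p) \<le> (\<Sum>p\<in>?C X \<union> {p \<in> ?C N. p > X}. ?w p)"
        by (rule sum_mono2) (auto intro!: w0)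
      also have "\<dots> \<le> S + (\<Sum>p | p \<in> ?C N \<and> p > X. ?w p)"
        unfolding S_def by (subst sum.union_disjoint) auto
      finally have "ln (real N) / t - B0 - S \<le> (\<Sum>p | p \<in> ?C N \<and> p > X. ?w p)"
        using B0[OF N0] by linarith
      hence "\<delta> * (ln (real N) / t - B0 - S) \<le> \<delta> * (\<Sum>p | p \<in> ?C N \<and> p > X. ?w p)"
        using \<delta>0 by (intro mult_left_mono) auto
      also have "\<dots> = (\<Sum>p | p \<in> ?C N \<and> p > X. \<delta> * ?w p)" by (rule sum_distrib_left)
      also have "\<dots> \<le> (\<Sum>p | p \<in> ?C N \<and> p > X. large_factor_sum z (p + 1) * ?w p)"
      proof (rule sum_mono)
        fix p assume p: "p \<in> {p. p \<in> ?C N \<and> p > X}"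
        hence "\<delta> \<le> large_factor_sum z (p + 1)" using neg by (auto simp: not_less)
        thus "\<delta> * ?w p \<le> large_factor_sum z (p + 1) * ?w p"
          using p by (intro mult_right_mono w0) auto
      qed
      also have "\<dots> \<le> (\<Sum>p\<in>?C N. large_factor_sum z (p + 1) * ?w p)"
      proof (rule sum_mono2)
        fix p assume "p \<in> ?C N - {p. p \<in> ?C N \<and> p > X}"
        hence "?w p \<ge> 0" by (intro w0) auto
        moreover have "large_factor_sum z (p + 1) \<ge> 0" unfolding large_factor_sum_def by (intro sum_nonneg) auto
        ultimately show "large_factor_sum z (p + 1) * ?w p \<ge> 0" by (rule mult_nonneg_nonneg[rotated])
      qed auto
      finally show ?thesis .
    qed
    have "(\<Sum>p\<in>?C N. large_factor_sum z (p + 1) * ?w p) = (\<Sum>p\<in>?C N. \<Sum>q | q \<in> ?Q \<and> q dvd p + 1. 1 / real q * ?w p)"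
    proof (rule sum.cong)
      fix p assume p: "p \<in> ?C N"
      hence "{q. prime q \<and> z < q \<and> q dvd p + 1} = {q. q \<in> ?Q \<and> q dvd p + 1}"
        by (auto dest: dvd_imp_le)
      thus "large_factor_sum z (p + 1) * ?w p = (\<Sum>q | q \<in> ?Q \<and> q dvd p + 1. 1 / real q * ?w p)"
        unfolding large_factor_sum_def by (simp only: sum_distrib_right)
    qed auto
    also have "\<dots> = (\<Sum>q\<in>?Q. \<Sum>p | p \<in> ?C N \<and> q dvd p + 1. 1 / real q * ?w p)"
      by (rule sum.swap_restrict) auto
    also have "\<dots> = (\<Sum>q\<in>?Q. 1 / real q * ?W q N)"
      unfolding sum_distrib_left by (intro sum.cong) auto
    also have "\<dots> = (\<Sum>q | prime q \<and> q \<in> {z<..Z}. 1 / real q * ?W q N) + (\<Sum>q | prime q \<and> q \<in> {Z<..N + 1}. 1 / real q * ?W q N)"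
      using Z N by (subst sum.union_disjoint[symmetric]) (auto intro!: sum.cong)
    also have "\<dots> \<le> (ln (real N) / (real z * t) + B') + 12 * \<kappa> * (2 + ln (real N))"
    proof (rule add_mono)
      have "(\<Sum>q | prime q \<and> q \<in> {z<..Z}. 1 / real q * ?W q N)
          \<le> (\<Sum>q | prime q \<and> q \<in> {z<..Z}. ln (real N) / t * (1 / (real q * (real q - 1))) + B q / real q)"
      proof (rule sum_mono)
        fix q assume q: "q \<in> {q. prime q \<and> q \<in> {z<..Z}}"
        have "1 / real q * ?W q N \<le> 1 / real q * (ln (real N) / (t * (real q - 1)) + B q)"
          using B[of q N] q N0 by (intro mult_left_mono) auto
        also have "\<dots> = ln (real N) / t * (1 / (real q * (real q - 1))) + B q / real q"
          by (simp add: distrib_left)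
        finally show "1 / real q * ?W q N \<le> ln (real N) / t * (1 / (real q * (real q - 1))) + B q / real q" .
      qed
      also have "\<dots> = ln (real N) / t * (\<Sum>q | prime q \<and> q \<in> {z<..Z}. 1 / (real q * (real q - 1))) + B'"
        unfolding B'_def sum.distrib sum_distrib_left ..
      also have "\<dots> \<le> ln (real N) / t * (1 / real z) + B'"
        using sum_inverse_pronic_le[of z Z] lnN t z by (intro add_mono mult_left_mono) auto
      finally show "(\<Sum>q | prime q \<and> q \<in> {z<..Z}. 1 / real q * ?W q N) \<le> ln (real N) / (real z * t) + B'"
        by (simp add: mult.commute)
      have "(\<Sum>q | prime q \<and> q \<in> {Z<..N + 1}. 1 / real q * ?W q N)
          \<le> (\<Sum>q | prime q \<and> q \<in> {Z<..N + 1}. 12 * (2 + ln (real N)) * (ln (real q) / real q ^ 2))"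
      proof (rule sum_mono)
        fix q assume q: "q \<in> {q. prime q \<and> q \<in> {Z<..N + 1}}"
        \<comment> \<open>For q > Z the condition modulo the primorial is dropped. This loses a
          factor t, which the division by t in \<kappa> makes up for.\<close>
        have "?W q N \<le> (\<Sum>p | p \<in> {1..N} \<and> prime p \<and> q dvd p + 1. ?w p)"
          by (rule sum_mono2) auto
        also have "\<dots> \<le> 12 * ln (real q) / real q * (2 + ln (real N))"
          using q Z N0 by (intro sum_ln_over_prime_neg1_le) auto
        finally have "1 / real q * ?W q N \<le> 1 / real q * (12 * ln (real q) / real q * (2 + ln (real N)))"
          by (intro mult_left_mono) auto
        thus "1 / real q * ?W q N \<le> 12 * (2 + ln (real N)) * (ln (real q) / real q ^ 2)"
          by (simp add: power2_eq_square mult_ac)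
      qed
      also have "\<dots> \<le> (\<Sum>q\<in>{Z..<N + 2}. 12 * (2 + ln (real N)) * (ln (real q) / real q ^ 2))"
        using lnN Z by (intro sum_mono2) auto
      also have "\<dots> = 12 * (2 + ln (real N)) * (\<Sum>q\<in>{Z..<N + 2}. ln (real q) / real q ^ 2)"
        by (rule sum_distrib_left[symmetric])
      also have "\<dots> \<le> 12 * (2 + ln (real N)) * \<kappa>"
        using Z0[OF Z(1), of "N + 2"] lnN by (intro mult_left_mono) auto
      finally show "(\<Sum>q | prime q \<and> q \<in> {Z<..N + 1}. 1 / real q * ?W q N) \<le> 12 * \<kappa> * (2 + ln (real N))"
        by (simp only: mult_ac)
    qed
    finally have "\<delta> * (ln (real N) / t - B0 - S) \<le> (ln (real N) / (real z * t) + B') + 12 * \<kappa> * (2 + ln (real N))"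
      using lower by linarith
    thus ?thesis by (simp add: algebra_simps)
  qed
  have coeff: "\<delta> / t - 1 / (real z * t) - 12 * \<kappa> = 12 * \<kappa>"
    using t by (simp add: \<kappa>_def diff_divide_distrib)
  define M where "M = (\<delta> * (B0 + S) + B' + 24 * \<kappa>) / (12 * \<kappa>)"
  obtain N where N: "real N > max (exp (M + 1)) (real Z)" using reals_Archimedean2 by blast
  have "N > 0" using N exp_gt_zero[of "M+1"] by (cases N) auto
  have "M + 1 \<le> ln (real N)" using N \<open>N > 0\<close> by (simp add: ln_ge_iff)
  moreover have "ln (real N) \<le> M"
    using bound[of N] N \<kappa> unfolding coeff M_def by (simp add: field_simps)
  ultimately show False by linarith
qed

text \<open>a is -1 modulo the product of S and 1 modulo the product of the other primes up to z;
  both are units. For an odd prime q outside S, p = 1 (mod q) gives p + 1 = 2 (mod q), which is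
  nonzero; hence 2 is put into S.\<close>

lemma exists_residue:
  assumes S: "S \<subseteq> {p. prime p \<and> p \<le> z}" "2 \<in> S"
  obtains a where "coprime a (primorial z)"
    "\<And>p q. [p = a] (mod primorial z) \<Longrightarrow> prime q \<Longrightarrow> q \<le> z \<Longrightarrow> q dvd p + 1 \<longleftrightarrow> q \<in> S"
proof -
  let ?R = "{p. prime p \<and> p \<le> z} - S"
  have fin: "finite S" "finite ?R" using S(1) by (auto intro: finite_subset)
  define M where "M = \<Prod>S"
  define R where "R = \<Prod>?R"
  have P: "primorial z = M * R"
    unfolding primorial_def M_def R_def using S(1) fin by (subst prod.union_disjoint[symmetric]) (auto intro!: prod.cong)
  have cop: "coprime M R"
    unfolding M_def R_def using S(1) by (intro prod_coprime_left prod_coprime_right) (auto intro!: primes_coprime)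
  have M0: "M > 0" unfolding M_def using S(1) by (intro prod_pos) (auto intro: prime_gt_0_nat)
  obtain a where a: "[a = M - 1] (mod M)" "[a = 1] (mod R)"
    using binary_chinese_remainder_nat[OF cop] by blast
  have "coprime a M"
    by (rule cong_imp_coprime[OF cong_sym[OF a(1)] coprime_diff_one_left_nat[OF M0]])
  moreover have "coprime a R" using cong_imp_coprime[OF cong_sym[OF a(2)]] by simp
  ultimately have copa: "coprime a (primorial z)" by (simp add: P)
  have "q dvd p + 1 \<longleftrightarrow> q \<in> S" if p: "[p = a] (mod primorial z)" and q: "prime q" "q \<le> z" for p q
  proof (cases "q \<in> S")
    case True
    have "[p = M - 1] (mod M)" using p a(1) unfolding P by (metis cong_modulus_mult_nat cong_trans)
    hence "[p + 1 = M - 1 + 1] (mod M)" by (rule cong_add) simp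
    hence "M dvd p + 1" using M0 by (simp add: cong_def dvd_eq_mod_eq_0)
    moreover have "q dvd M" unfolding M_def using True fin by (intro dvd_prodI[where f = "\<lambda>x. x"]) auto
    ultimately show ?thesis using True dvd_trans by blast
  next
    case False
    have "q dvd R" unfolding R_def using False q fin by (intro dvd_prodI[where f = "\<lambda>x. x"]) auto
    moreover have "[p = 1] (mod R)" using p a(2) unfolding P by (metis cong_modulus_mult_nat cong_trans mult.commute)
    ultimately have "[p = 1] (mod q)" by (rule cong_dvd_modulus_nat[rotated])
    hence "[p + 1 = 1 + 1] (mod q)" by (rule cong_add) simp
    hence "q dvd p + 1 \<longleftrightarrow> q dvd 1 + 1" by (rule cong_dvd_iff)
    hence "q dvd p + 1 \<longleftrightarrow> q dvd 2" by (simp only: one_add_one)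
    moreover have "\<not> q dvd 2" using False S(2) q(1) by (metis primes_dvd_imp_eq two_is_prime_nat)
    ultimately show ?thesis using False by simp
  qed
  thus ?thesis using that copa by blast
qed

text \<open>The ratio is F * G * H. F collects the primes up to w and lies between \<alpha> (1 -
  \<delta>) and \<alpha>; G >= 1 - \<delta> collects the larger primes dividing p + 1; H = 1 + 2/(p
  - 1) <= 1 + \<delta>. As (1 - \<delta>)^2 >= 1 - 2 \<delta>, the error is at most 2
  \<delta>.\<close>

lemma exists_prime_ratio_close:
  assumes \<alpha>: "0 < \<alpha>" "\<alpha> \<le> 1 / 2" and \<delta>: "0 < \<delta>" "\<delta> < 1"
  shows "\<exists>p. prime p \<and> \<bar>real (totient (p + 1)) / real (totient p) - \<alpha>\<bar> \<le> 2 * \<delta>"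
proof -
  obtain y where y: "y \<ge> 2" "1 / real y < \<delta>"
  proof -
    obtain y0 where "1 / real (Suc y0) < \<delta>" using \<delta>(1) nat_approx_posE by blast
    moreover have "1 / real (Suc (Suc y0)) \<le> 1 / real (Suc y0)" by (intro divide_left_mono) auto
    ultimately show ?thesis by (intro that[of "Suc (Suc y0)"]) auto
  qed
  \<comment> \<open>The target is doubled because 2 belongs to S and contributes the factor 1/2;
    \<alpha> <= 1/2 keeps the doubled target at most 1.\<close>
  obtain w where w: "w \<ge> y" "euler_prod y w \<le> 2 * \<alpha>" "2 * \<alpha> * (1 - 1 / real y) \<le> euler_prod y w"
    using euler_prod_approx[of "2 * \<alpha>" y] \<alpha> y by auto
  have z: "w \<ge> 2" "1 / real w < \<delta>"
  proof -
    have "1 / real w \<le> 1 / real y" using w y by (intro divide_left_mono) auto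
    thus "1 / real w < \<delta>" using y by linarith
  qed (use w y in auto)
  define S where "S = insert 2 {p. prime p \<and> p \<in> {y<..w}}"
  have S: "S \<subseteq> {p. prime p \<and> p \<le> w}" "2 \<in> S" using z by (auto simp: S_def)
  have finS: "finite S" using S(1) by (rule finite_subset) simp
  obtain a where a: "coprime a (primorial w)"
    "\<And>p q. [p = a] (mod primorial w) \<Longrightarrow> prime q \<Longrightarrow> q \<le> w \<Longrightarrow> q dvd p + 1 \<longleftrightarrow> q \<in> S"
    using exists_residue[OF S] by blast
  obtain X where X: "real X > 2 / \<delta>" using reals_Archimedean2 by blast
  \<comment> \<open>p > X + 1 gives p - 1 > X > 2/\<delta>, which bounds H.\<close>
  obtain p where p: "p > X + 1" "prime p" "[p = a] (mod primorial w)" "large_factor_sum w (p + 1) < \<delta>"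
    using exists_prime_small_large_factor_sum[OF z(1) a(1) z(2), of "X + 1"] by blast
  define Q where "Q = {q. prime q \<and> w < q \<and> q dvd p + 1}"
  have finQ: "finite Q" unfolding Q_def by (rule finite_subset[of _ "{..p + 1}"]) (auto dest: dvd_imp_le)
  have pf: "prime_factors (p + 1) = S \<union> Q"
  proof (intro equalityI subsetI)
    fix q assume "q \<in> prime_factors (p + 1)"
    hence "prime q" "q dvd p + 1" by (auto simp: in_prime_factors_iff)
    thus "q \<in> S \<union> Q" using a(2)[OF p(3), of q] by (auto simp: Q_def not_le)
  next
    fix q assume "q \<in> S \<union> Q"
    thus "q \<in> prime_factors (p + 1)"
      using a(2)[OF p(3), of q] S(1) by (auto simp: Q_def in_prime_factors_iff)
  qed
  define F where "F = (\<Prod>q\<in>S. 1 - 1 / real q)"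
  define G where "G = (\<Prod>q\<in>Q. 1 - 1 / real q)"
  have F: "F = euler_prod y w / 2"
    unfolding F_def S_def euler_prod_def using y by (subst prod.insert) auto
  have F1: "F \<le> \<alpha>" "\<alpha> * (1 - \<delta>) \<le> F"
  proof -
    have "\<alpha> * (1 - \<delta>) \<le> \<alpha> * (1 - 1 / real y)" using y \<alpha> by (intro mult_left_mono) auto
    thus "\<alpha> * (1 - \<delta>) \<le> F" using w unfolding F by simp
  qed (use w F in simp)
  have G1: "G \<le> 1" "1 - \<delta> \<le> G"
  proof -
    show "G \<le> 1" unfolding G_def by (intro prod_le_1) (auto simp: Q_def dest: prime_gt_0_nat)
    have "1 - (\<Sum>q\<in>Q. 1 / real q) \<le> G"
      unfolding G_def using finQ by (intro prod_one_minus_ge) (auto simp: Q_def dest: prime_gt_0_nat)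
    thus "1 - \<delta> \<le> G" using p(4) by (simp add: large_factor_sum_def Q_def)
  qed
  have "S \<inter> Q = {}" using S(1) by (auto simp: Q_def)
  hence "real (totient (p + 1)) = real (p + 1) * (F * G)"
    unfolding totient_formula2 pf F_def G_def using finS finQ by (subst prod.union_disjoint) auto
  moreover have "real (totient p) = real p - 1"
    using p(2) by (simp add: totient_prime of_nat_diff prime_gt_0_nat Suc_leI)
  ultimately have ratio: "real (totient (p + 1)) / real (totient p) = F * G * (real (p + 1) / (real p - 1))" by simp
  define H where "H = real (p + 1) / (real p - 1)"
  have H: "1 \<le> H" "H \<le> 1 + \<delta>"
  proof -
    have X0: "0 < real X" using X \<delta> by (meson divide_pos_pos less_trans zero_less_numeral)
    have pX: "real p - 1 > real X" using p(1) by linarith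
    have "H = 1 + 2 / (real p - 1)" unfolding H_def using pX X0 by (simp add: field_simps)
    moreover have "2 / (real p - 1) \<le> \<delta>"
    proof -
      have "2 \<le> \<delta> * real X" using X \<delta> by (simp add: field_simps)
      also have "\<dots> \<le> \<delta> * (real p - 1)" using pX \<delta> by (intro mult_left_mono) auto
      finally show ?thesis using pX X0 by (simp add: field_simps)
    qed
    ultimately show "1 \<le> H" "H \<le> 1 + \<delta>" using pX X0 by auto
  qed
  have F0: "F \<ge> 0" unfolding F by (simp add: euler_prod_nonneg)
  have "F * G * H \<le> \<alpha> * 1 * (1 + \<delta>)"
    using F1 G1 H F0 \<alpha> \<delta> by (intro mult_mono) auto
  also have "\<dots> = \<alpha> + \<alpha> * \<delta>" by (simp add: algebra_simps)
  also have "\<dots> \<le> \<alpha> + 1 * \<delta>" using \<alpha> \<delta> by (intro add_left_mono mult_right_mono) auto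
  finally have upper: "F * G * H \<le> \<alpha> + 2 * \<delta>" using \<delta> by linarith
  have "\<alpha> - 2 * \<delta> \<le> \<alpha> * (1 - 2 * \<delta>)"
  proof -
    have "\<alpha> * \<delta> \<le> 1 * \<delta>" using \<alpha> \<delta> by (intro mult_right_mono) auto
    thus ?thesis by (simp add: algebra_simps)
  qed
  also have "\<dots> \<le> \<alpha> * ((1 - \<delta>) * (1 - \<delta>))"
    using \<alpha> by (intro mult_left_mono) (auto simp: algebra_simps)
  also have "\<dots> = \<alpha> * (1 - \<delta>) * (1 - \<delta>) * 1" by simp
  also have "\<dots> \<le> F * G * H"
    using F1 G1 H F0 \<alpha> \<delta> by (intro mult_mono) auto
  finally have "\<alpha> - 2 * \<delta> \<le> F * G * H" .
  hence "\<bar>F * G * H - \<alpha>\<bar> \<le> 2 * \<delta>" using upper by linarith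
  thus ?thesis using p(2) ratio unfolding H_def by (intro exI[of _ p]) (simp only:)
qed

theorem theorem2:
  shows "{0..1/2::real} \<subseteq> closure {real (totient (p+1)) / real (totient p) | p::nat. prime p}"
proof
  fix x :: real assume x: "x \<in> {0..1/2}"
  show "x \<in> closure {real (totient (p+1)) / real (totient p) | p::nat. prime p}"
    unfolding closure_approachable
  proof (intro allI impI)
    fix e :: real assume e: "e > 0"
    \<comment> \<open>The total distance is at most 2 \<delta> + \<delta> < e. The maximum with
      \<delta> makes the target positive even for x = 0, and \<delta> <= 1/4 keeps it at most
      1/2.\<close>
    define \<delta> where "\<delta> = min (1/4) (e / 8)"
    define \<alpha> where "\<alpha> = max x \<delta>"
    have \<delta>: "0 < \<delta>" "\<delta> < 1" using e by (auto simp: \<delta>_def)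
    have \<alpha>: "0 < \<alpha>" "\<alpha> \<le> 1/2" "\<bar>\<alpha> - x\<bar> \<le> \<delta>" using x \<delta> by (auto simp: \<alpha>_def \<delta>_def)
    obtain p where p: "prime p" "\<bar>real (totient (p + 1)) / real (totient p) - \<alpha>\<bar> \<le> 2 * \<delta>"
      using exists_prime_ratio_close[OF \<alpha>(1,2) \<delta>] by blast
    have "3 * \<delta> < e" using e by (auto simp: \<delta>_def min_def)
    hence "dist (real (totient (p + 1)) / real (totient p)) x < e"
      using p(2) \<alpha>(3) unfolding dist_real_def by linarith
    thus "\<exists>y\<in>{real (totient (p+1)) / real (totient p) | p::nat. prime p}. dist y x < e"
      using p(1) by blast
  qed
qed

end
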